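(* Let $K$ be a field and let $L=(x_1^2,x_1x_2,\ldots,x_1x_{100},x_2^2,x_2x_3,\ldots,x_2x_{13})\subset S=K[x_1,\ldots,x_{100}]$, a lex ideal generated by monomials of degree $2$. Then $H_L(t)=112t^2+6172t^3+\cdots$ (no terms of degree less than $2$), but $\mathrm{hdepth}(L)\leq 54$; in particular $\mathrm{hdepth}(L)\neq\lfloor\frac{6172}{112}\rfloor=55$. Moreover, let $L^\sigma=(x_1x_2,x_1x_3,\ldots,x_1x_{101},x_2x_3,x_2x_4,\ldots,x_2x_{14})\subset S'=K[x_1,\ldots,x_{101}]$, a squarefree lex ideal generated by squarefree monomials of degree $2$. Then $H_{L^\sigma}(t)=112t^2+6284t^3+\cdots$, but $\mathrm{hdepth}(L^\sigma)=\mathrm{hdepth}(L)+1\leq 55$; in particular $\mathrm{hdepth}(L^\sigma)\neq\lfloor\frac{6284}{112}\rfloor=56$.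
   Context: Polynomial rings $K[x_1,\ldots,x_n]$ are $\mathbb{Z}$-graded with $\deg(x_i)=1$; $H_I(t)=\sum_k\dim_K(I_k)t^k$ is the Hilbert series of a graded ideal $I$. A Hilbert decomposition of a graded ideal $I$ is an isomorphism of graded $K$-vector spaces $\mathcal{H}: I\cong\bigoplus_{i=1}^m K[Z_i](-s_i)$ with $s_i\in\mathbb{Z}_{\geq 0}$ and $Z_i\subset\{x_1,\ldots,x_n\}$. Its Hilbert depth is $\mathrm{hdepth}(\mathcal{H})=\min_i|Z_i|$, and $\mathrm{hdepth}(I)$ is the maximum of $\mathrm{hdepth}(\mathcal{H})$ over all Hilbert decompositions $\mathcal{H}$ of $I$. A (squarefree) lex ideal is a (squarefree) monomial ideal $I$ such that whenever $u\in I$ and $v$ are (squarefree) monomials of the same degree with $v>_{\mathrm{lex}}u$ (with $x_1>x_2>\cdots$), then $v\in I$. *)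

theory Defs
  imports
    "HOL-Library.Poly_Mapping"
    "HOL-Computational_Algebra.Formal_Power_Series"
    "HOL-Algebra.Ideal"
begin

(* A monomial x_1^{a_1} ... x_n^{a_n} is represented by its exponent vector u :: nat =>_0 nat,
   and a polynomial by its finitely supported coefficient function; the ring structure is the
   convolution product of HOL-Library.Poly_Mapping.  The variables are indexed by all of nat, so
   K[x_1,...,x_n] is the subring of polynomials in the variables with index in {1..n}. *)
type_synonym 'k mpoly = "(nat \<Rightarrow>\<^sub>0 nat) \<Rightarrow>\<^sub>0 'k"

definition monomial :: "(nat \<Rightarrow>\<^sub>0 nat) \<Rightarrow> 'k::comm_ring_1 mpoly" where
  "monomial u = Poly_Mapping.single u 1"

definition Var :: "nat \<Rightarrow> 'k::comm_ring_1 mpoly" where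
  "Var i = monomial (Poly_Mapping.single i 1)"

definition mdeg :: "(nat \<Rightarrow>\<^sub>0 nat) \<Rightarrow> nat" where
  "mdeg u = (\<Sum>i\<in>Poly_Mapping.keys u. Poly_Mapping.lookup u i)"

definition monomials_in :: "nat set \<Rightarrow> (nat \<Rightarrow>\<^sub>0 nat) set" where
  "monomials_in Z = {u. Poly_Mapping.keys u \<subseteq> Z}"

definition squarefree_monomials_in :: "nat set \<Rightarrow> (nat \<Rightarrow>\<^sub>0 nat) set" where
  "squarefree_monomials_in Z =
     {u \<in> monomials_in Z. \<forall>i. Poly_Mapping.lookup u i \<le> 1}"

(* K[Z], where Z is the set of indices of the variables *)
definition polys_in :: "nat set \<Rightarrow> 'k::comm_ring_1 mpoly set" where
  "polys_in Z = {p. Poly_Mapping.keys p \<subseteq> monomials_in Z}"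

definition poly_ring :: "nat \<Rightarrow> 'k::comm_ring_1 mpoly ring" where
  "poly_ring n = \<lparr>carrier = polys_in {1..n}, monoid.mult = (*), one = 1, zero = 0, add = (+)\<rparr>"

lemma polys_in_mult:
  assumes "p \<in> polys_in Z" "q \<in> polys_in Z"
  shows "p * q \<in> polys_in Z"
proof -
  have "Poly_Mapping.keys w \<subseteq> Z" if pq: "w \<in> Poly_Mapping.keys (p * q)" for w
  proof -
    obtain u v where w: "w = u + v" "u \<in> Poly_Mapping.keys p" "v \<in> Poly_Mapping.keys q"
      using subsetD[OF keys_mult pq] by auto
    then have "Poly_Mapping.keys u \<union> Poly_Mapping.keys v \<subseteq> Z"
      using assms by (auto simp: polys_in_def monomials_in_def)
    then show ?thesis
      using keys_add[of u v] w(1) by blast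
  qed
  then show ?thesis
    by (auto simp: polys_in_def monomials_in_def)
qed

lemma cring_poly_ring: "cring (poly_ring n :: 'k::comm_ring_1 mpoly ring)"
proof (rule cringI)
  have add: "p + q \<in> polys_in Z" if "p \<in> polys_in Z" "q \<in> polys_in Z"
    for p q :: "'k mpoly" and Z
    using that keys_add[of p q] by (fastforce simp: polys_in_def)
  show "abelian_group (poly_ring n :: 'k mpoly ring)"
  proof (rule abelian_groupI)
    fix p assume "p \<in> carrier (poly_ring n :: 'k mpoly ring)"
    then show "\<exists>q\<in>carrier (poly_ring n). q \<oplus>\<^bsub>poly_ring n\<^esub> p = \<zero>\<^bsub>poly_ring n\<^esub>"
      by (intro bexI[of _ "- p"]) (auto simp: poly_ring_def polys_in_def in_keys_iff lookup_uminus subset_iff)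
  qed (auto simp: poly_ring_def add algebra_simps, auto simp: polys_in_def)
  show "comm_monoid (poly_ring n :: 'k mpoly ring)"
    by (rule comm_monoidI)
      (auto simp: poly_ring_def polys_in_mult algebra_simps, auto simp: polys_in_def monomials_in_def)
qed (auto simp: poly_ring_def algebra_simps)

definition ideal_gen :: "nat \<Rightarrow> 'k::comm_ring_1 mpoly set \<Rightarrow> 'k mpoly set" where
  "ideal_gen n G = Idl\<^bsub>poly_ring n\<^esub> G"


definition is_monomial_ideal :: "nat \<Rightarrow> 'k::comm_ring_1 mpoly set \<Rightarrow> bool" where
  "is_monomial_ideal n I \<longleftrightarrow>
     (\<exists>M \<subseteq> monomials_in {1..n}. I = ideal_gen n (monomial ` M))"

definition is_squarefree_monomial_ideal :: "nat \<Rightarrow> 'k::comm_ring_1 mpoly set \<Rightarrow> bool" where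
  "is_squarefree_monomial_ideal n I \<longleftrightarrow>
     (\<exists>M \<subseteq> squarefree_monomials_in {1..n}. I = ideal_gen n (monomial ` M))"

(* The library order on nat =>_0 nat is the lexicographic order with x_1 > x_2 > ... *)
lemma lex_less_iff:
  fixes u v :: "nat \<Rightarrow>\<^sub>0 nat"
  shows "v > u \<longleftrightarrow>
     (\<exists>i. Poly_Mapping.lookup v i > Poly_Mapping.lookup u i \<and>
          (\<forall>j<i. Poly_Mapping.lookup v j = Poly_Mapping.lookup u j))"
  by (auto simp: less_poly_mapping.rep_eq less_fun_def)

definition is_lex_ideal :: "nat \<Rightarrow> 'k::comm_ring_1 mpoly set \<Rightarrow> bool" where
  "is_lex_ideal n I \<longleftrightarrow> is_monomial_ideal n I \<and>
     (\<forall>u \<in> monomials_in {1..n}. \<forall>v \<in> monomials_in {1..n}.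
        monomial u \<in> I \<and> mdeg v = mdeg u \<and> v > u \<longrightarrow> monomial v \<in> I)"

definition is_squarefree_lex_ideal :: "nat \<Rightarrow> 'k::comm_ring_1 mpoly set \<Rightarrow> bool" where
  "is_squarefree_lex_ideal n I \<longleftrightarrow> is_squarefree_monomial_ideal n I \<and>
     (\<forall>u \<in> squarefree_monomials_in {1..n}. \<forall>v \<in> squarefree_monomials_in {1..n}.
        monomial u \<in> I \<and> mdeg v = mdeg u \<and> v > u \<longrightarrow> monomial v \<in> I)"


definition homogeneous :: "nat \<Rightarrow> 'k::comm_ring_1 mpoly \<Rightarrow> bool" where
  "homogeneous k p \<longleftrightarrow> (\<forall>u\<in>Poly_Mapping.keys p. mdeg u = k)"

definition graded_part :: "'k::comm_ring_1 mpoly set \<Rightarrow> nat \<Rightarrow> 'k mpoly set" where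
  "graded_part V k = {p \<in> V. homogeneous k p}"

definition mscale :: "'k::comm_ring_1 \<Rightarrow> 'k mpoly \<Rightarrow> 'k mpoly" where
  "mscale c p = Poly_Mapping.map ((*) c) p"

lemma vector_space_mscale: "vector_space (mscale :: 'k::field \<Rightarrow> _)"
  by unfold_locales
    (simp_all add: mscale_def mult_map_scale_conv_mult distrib_left distrib_right single_add
      mult_single flip: mult.assoc)

definition hilbert_series :: "'k::field mpoly set \<Rightarrow> int fps" where
  "hilbert_series I = Abs_fps (\<lambda>k. int (vector_space.dim mscale (graded_part I k)))"


(* A list D = [(Z_1,s_1),...,(Z_m,s_m)] encodes the graded K-vector space
   K[Z_1](-s_1) + ... + K[Z_m](-s_m) (external direct sum), whose elements are the families
   (f_i)_{i<m} with f_i in K[Z_i].  As all s_i are >= 0, its components of negative degree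
   vanish, so degrees can be taken in nat. *)
definition direct_sum :: "(nat set \<times> nat) list \<Rightarrow> (nat \<Rightarrow>\<^sub>0 'k::comm_ring_1 mpoly) set" where
  "direct_sum D = {f. Poly_Mapping.keys f \<subseteq> {..<length D} \<and>
     (\<forall>i<length D. Poly_Mapping.lookup f i \<in> polys_in (fst (D ! i)))}"

(* the component of degree k of K[Z](-s) is that of degree k - s of K[Z] *)
definition shifted_part :: "nat set \<Rightarrow> nat \<Rightarrow> nat \<Rightarrow> 'k::comm_ring_1 mpoly set" where
  "shifted_part Z s k = (if s \<le> k then graded_part (polys_in Z) (k - s) else {0})"

definition direct_sum_part ::
    "(nat set \<times> nat) list \<Rightarrow> nat \<Rightarrow> (nat \<Rightarrow>\<^sub>0 'k::comm_ring_1 mpoly) set" where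
  "direct_sum_part D k = {f \<in> direct_sum D.
     \<forall>i<length D. Poly_Mapping.lookup f i \<in> shifted_part (fst (D ! i)) (snd (D ! i)) k}"

definition graded_iso ::
    "'k::field mpoly set \<Rightarrow> (nat set \<times> nat) list \<Rightarrow> ('k mpoly \<Rightarrow> (nat \<Rightarrow>\<^sub>0 'k mpoly)) \<Rightarrow> bool" where
  "graded_iso I D \<phi> \<longleftrightarrow>
     bij_betw \<phi> I (direct_sum D) \<and>
     (\<forall>p\<in>I. \<forall>q\<in>I. \<phi> (p + q) = \<phi> p + \<phi> q) \<and>
     (\<forall>c. \<forall>p\<in>I. \<phi> (mscale c p) = Poly_Mapping.map (mscale c) (\<phi> p)) \<and>
     (\<forall>k. \<phi> ` graded_part I k = direct_sum_part D k)"

definition is_hilbert_decomposition ::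
    "nat \<Rightarrow> 'k::field mpoly set \<Rightarrow> (nat set \<times> nat) list \<Rightarrow> bool" where
  "is_hilbert_decomposition n I D \<longleftrightarrow>
     (\<forall>(Z, s)\<in>set D. Z \<subseteq> {1..n}) \<and> (\<exists>\<phi>. graded_iso I D \<phi>)"

(* only meaningful for nonempty D, i.e. for decompositions of nonzero ideals *)
definition decomposition_hdepth :: "(nat set \<times> nat) list \<Rightarrow> nat" where
  "decomposition_hdepth D = Min {card Z | Z s. (Z, s) \<in> set D}"

definition hdepth :: "nat \<Rightarrow> 'k::field mpoly set \<Rightarrow> nat" where
  "hdepth n I = Max {decomposition_hdepth D | D. is_hilbert_decomposition n I D}"

end

theory Submission
  imports Defs
begin

unbundle fps_syntax

text \<open>Comparing dimensions degree by degree, a graded ideal \<open>I\<close> spanned by monomials has a Hilbert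
  decomposition into the \<open>K[Z\<^sub>i](-s\<^sub>i)\<close> iff \<open>H\<^sub>I = \<Sum>\<^sub>i t\<^bsup>s\<^sub>i\<^esup> / (1 - t)\<^bsup>|Z\<^sub>i|\<^esup>\<close>, so Hilbert depth only
  depends on \<open>H\<^sub>I\<close> and the number of variables. If all \<open>|Z\<^sub>i| \<ge> 55\<close>, then \<open>(1 - t)\<^sup>5\<^sup>5 H\<^sub>L\<close> has nonnegative
  coefficients; but its coefficient of \<open>t\<^sup>5\<close> is \<open>-20470\<close>. Sorting the monomials of \<open>L\<close> and \<open>L\<^sup>\<sigma>\<close> by the
  least variable of a cofactor gives \<open>H(L\<^sup>\<sigma>) = H(L) / (1 - t)\<close>, so the decompositions of \<open>L\<^sup>\<sigma>\<close> of
  positive depth are those of \<open>L\<close> with one variable added to every \<open>Z\<^sub>i\<close>.\<close>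

text \<open>The quotient 6172/112 only looks at degrees 2 and 3: (1 - t)^55 H_L begins 112 t^2 + 12
  t^3 + 51646 t^4, and degree 5 is the first with a negative coefficient. The cause is visible in
  the closed form H_L = t ((1 - t)^(-100) + (1 - t)^(-99) - (1 - t)^(-87) - 1). Multiplication by (1
  - t)^55 turns the final -1 into -(1 - t)^55, whose signs alternate, and its coefficient -341055 at
  t^4 tips the balance.

  Two features of the definitions shape the argument. A Hilbert decomposition is a linear
  isomorphism onto an external direct sum, whose basis consists of pairs of a summand number and a
  monomial; hence both sides are treated as coefficient functions supported on a set of indices of
  arbitrary type. And \<open>hdepth\<close> is a \<open>Max\<close> of values of \<open>Min\<close>,
  so both have to range over finite nonempty sets: a nonzero series excludes the empty
  decomposition, the number of variables bounds the depth, and a Stanley decomposition of L supplies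
  one element.\<close>

section \<open>Linear algebra of coefficient functions with prescribed support\<close>

definition supported_on :: "'a set \<Rightarrow> ('a \<Rightarrow>\<^sub>0 'k::zero) set" where
  "supported_on A = {p. Poly_Mapping.keys p \<subseteq> A}"

lemma supported_onI:
  assumes "\<And>x. Poly_Mapping.lookup p x \<noteq> 0 \<Longrightarrow> x \<in> A"
  shows "p \<in> supported_on A"
  using assms by (auto simp: supported_on_def in_keys_iff)

lemma lookup_supported_on:
  assumes "p \<in> supported_on A" "x \<notin> A"
  shows "Poly_Mapping.lookup p x = 0"
  using assms by (auto simp: supported_on_def in_keys_iff)

lemma supported_on_add:
  assumes "p \<in> supported_on A" "q \<in> supported_on A"
  shows "p + q \<in> supported_on A"
  using assms keys_add[of p q] by (auto simp: supported_on_def)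

lemma polys_in_eq: "polys_in Z = supported_on (monomials_in Z)"
  by (simp add: polys_in_def supported_on_def)

text \<open>\<open>mscale\<close> for an arbitrary index type: the same linear algebra has to serve
  polynomials and coefficient functions on pairs of a summand number and a monomial.\<close>

definition pscale :: "'k::field \<Rightarrow> ('a \<Rightarrow>\<^sub>0 'k) \<Rightarrow> ('a \<Rightarrow>\<^sub>0 'k)" where
  "pscale c p = Poly_Mapping.map ((*) c) p"

lemma lookup_pscale [simp]: "Poly_Mapping.lookup (pscale c p) x = c * Poly_Mapping.lookup p x"
  by (simp add: pscale_def map.rep_eq when_def)

lemma mscale_eq_pscale: "mscale = pscale"
  by (intro ext) (simp add: mscale_def pscale_def)

lemma vector_space_pscale: "vector_space pscale"
  by unfold_locales (auto intro!: poly_mapping_eqI simp: lookup_add algebra_simps)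

lemma supported_on_pscale: "p \<in> supported_on A \<Longrightarrow> pscale c p \<in> supported_on A"
  by (auto simp: supported_on_def in_keys_iff)

lemma poly_mapping_eq_sum_singles:
  assumes "finite F" "Poly_Mapping.keys p \<subseteq> F"
  shows "p = (\<Sum>a\<in>F. pscale (Poly_Mapping.lookup p a) (Poly_Mapping.single a 1))"
proof (rule poly_mapping_eqI)
  fix x
  have "(\<Sum>a\<in>F. Poly_Mapping.lookup p a * Poly_Mapping.lookup (Poly_Mapping.single a 1) x)
      = (\<Sum>a\<in>F. if a = x then Poly_Mapping.lookup p a else 0)"
    by (intro sum.cong) (auto simp: lookup_single when_def)
  also have "\<dots> = Poly_Mapping.lookup p x"
    using assms by (auto simp: in_keys_iff)
  finally show "Poly_Mapping.lookup p x = Poly_Mapping.lookup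
      (\<Sum>a\<in>F. pscale (Poly_Mapping.lookup p a) (Poly_Mapping.single a 1)) x"
    by (simp add: lookup_sum)
qed

lemma inj_single_one: "inj (\<lambda>a. Poly_Mapping.single a (1::'k::zero_neq_one))"
  by (rule injI) (metis lookup_single_eq lookup_single_not_eq zero_neq_one)

lemma span_singles:
  "module.span pscale ((\<lambda>a. Poly_Mapping.single a (1::'k::field)) ` A) = supported_on A"
proof -
  interpret V: vector_space "pscale :: 'k \<Rightarrow> ('a \<Rightarrow>\<^sub>0 'k) \<Rightarrow> _"
    by (rule vector_space_pscale)
  show ?thesis
  proof (intro equalityI subsetI)
    fix p :: "'a \<Rightarrow>\<^sub>0 'k" assume "p \<in> V.span ((\<lambda>a. Poly_Mapping.single a 1) ` A)"
    moreover have "V.span ((\<lambda>a. Poly_Mapping.single a 1) ` A) \<subseteq> supported_on A"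
      by (rule V.span_minimal)
        (auto simp: V.subspace_def supported_on_add supported_on_pscale, auto simp: supported_on_def)
    ultimately show "p \<in> supported_on A" by blast
  next
    fix p :: "'a \<Rightarrow>\<^sub>0 'k" assume "p \<in> supported_on A"
    then have "(\<Sum>a\<in>Poly_Mapping.keys p. pscale (Poly_Mapping.lookup p a) (Poly_Mapping.single a 1))
        \<in> V.span ((\<lambda>a. Poly_Mapping.single a 1) ` A)"
      by (intro V.span_sum V.span_scale V.span_base) (auto simp: supported_on_def)
    then show "p \<in> V.span ((\<lambda>a. Poly_Mapping.single a 1) ` A)"
      using poly_mapping_eq_sum_singles[of "Poly_Mapping.keys p" p] by simp
  qed
qed

lemma independent_singles:
  "\<not> module.dependent pscale ((\<lambda>a. Poly_Mapping.single a (1::'k::field)) ` A)"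
proof -
  interpret V: vector_space "pscale :: 'k \<Rightarrow> ('a \<Rightarrow>\<^sub>0 'k) \<Rightarrow> _"
    by (rule vector_space_pscale)
  show ?thesis
  proof
    assume "V.dependent ((\<lambda>a. Poly_Mapping.single a 1) ` A)"
    then obtain a where "a \<in> A" and a: "Poly_Mapping.single a 1 \<in>
        V.span ((\<lambda>a. Poly_Mapping.single a (1::'k)) ` A - {Poly_Mapping.single a 1})"
      by (auto simp: V.dependent_def)
    have "(\<lambda>a. Poly_Mapping.single a (1::'k)) ` A - {Poly_Mapping.single a 1}
        \<subseteq> (\<lambda>a. Poly_Mapping.single a 1) ` (A - {a})" by auto
    from subsetD[OF V.span_mono[OF this] a] show False
      unfolding span_singles by (simp add: supported_on_def)
  qed
qed

lemma dim_supported_on: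
  "vector_space.dim pscale (supported_on A :: ('a \<Rightarrow>\<^sub>0 'k::field) set) = card A"
proof -
  interpret V: vector_space "pscale :: 'k \<Rightarrow> ('a \<Rightarrow>\<^sub>0 'k) \<Rightarrow> _"
    by (rule vector_space_pscale)
  show ?thesis
    using V.dim_span_eq_card_independent[OF independent_singles, of A]
    by (simp add: span_singles card_image inj_on_subset[OF inj_single_one])
qed

text \<open>An injective linear map sends the unit vectors of \<open>A\<close> to independent
  vectors, and these lie in the span of the \<open>card B\<close> unit vectors of
  \<open>B\<close>.\<close>

lemma card_le_of_injective_on_supported_on:
  fixes f :: "('a \<Rightarrow>\<^sub>0 'k::field) \<Rightarrow> ('b \<Rightarrow>\<^sub>0 'k)"
  assumes "finite B"
    and inj: "inj_on f (supported_on A)" and into: "f ` supported_on A \<subseteq> supported_on B"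
    and add: "\<And>p q. p \<in> supported_on A \<Longrightarrow> q \<in> supported_on A \<Longrightarrow> f (p + q) = f p + f q"
    and scale: "\<And>c p. p \<in> supported_on A \<Longrightarrow> f (pscale c p) = pscale c (f p)"
  shows "card A \<le> card B"
proof -
  interpret V: vector_space "pscale :: 'k \<Rightarrow> ('a \<Rightarrow>\<^sub>0 'k) \<Rightarrow> _"
    by (rule vector_space_pscale)
  interpret W: vector_space "pscale :: 'k \<Rightarrow> ('b \<Rightarrow>\<^sub>0 'k) \<Rightarrow> _"
    by (rule vector_space_pscale)
  interpret VW: vector_space_pair "pscale :: 'k \<Rightarrow> ('a \<Rightarrow>\<^sub>0 'k) \<Rightarrow> _"
    "pscale :: 'k \<Rightarrow> ('b \<Rightarrow>\<^sub>0 'k) \<Rightarrow> _" ..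
  \<comment> \<open>\<open>f\<close> is additive and homogeneous only on
    \<open>supported_on A\<close>, while \<open>Vector_Spaces.linear\<close> speaks of total maps.
    Composing with the coordinate projection \<open>r\<close> gives a total linear map that agrees
    with \<open>f\<close> on \<open>supported_on A\<close>.\<close>
  define r :: "('a \<Rightarrow>\<^sub>0 'k) \<Rightarrow> ('a \<Rightarrow>\<^sub>0 'k)" where
    "r p = Poly_Mapping.mapp (\<lambda>x c. if x \<in> A then c else 0) p" for p
  have r [simp]: "Poly_Mapping.lookup (r p) x = (if x \<in> A then Poly_Mapping.lookup p x else 0)" for p x
    by (auto simp: r_def mapp.rep_eq in_keys_iff)
  have rA: "r p \<in> supported_on A" for p
    by (rule supported_onI) (simp split: if_splits)
  have r_id: "r p = p" if "p \<in> supported_on A" for p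
    using that by (intro poly_mapping_eqI) (auto simp: lookup_supported_on)
  let ?S = "(\<lambda>a. Poly_Mapping.single a (1::'k)) ` A"
  have r_add: "r (p + q) = r p + r q" for p q
    by (intro poly_mapping_eqI) (simp add: lookup_add)
  have r_scale: "r (pscale c p) = pscale c (r p)" for c p
    by (intro poly_mapping_eqI) simp
  have lin: "Vector_Spaces.linear pscale pscale (f \<circ> r)"
    by (subst Vector_Spaces.linear_iff) (auto simp: r_add r_scale add scale rA V.vector_space_axioms
        W.vector_space_axioms)
  have inj': "inj_on (f \<circ> r) (V.span ?S)"
    unfolding span_singles using inj by (auto simp: inj_on_def r_id)
  have "W.independent ((f \<circ> r) ` ?S)"
    by (rule VW.linear_independent_injective_image[OF lin independent_singles inj'])
  moreover have "(f \<circ> r) ` ?S \<subseteq> W.span ((\<lambda>b. Poly_Mapping.single b 1) ` B)"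
    unfolding span_singles using into rA by auto
  ultimately have "card ((f \<circ> r) ` ?S) \<le> card ((\<lambda>b. Poly_Mapping.single b (1::'k)) ` B)"
    using W.independent_span_bound \<open>finite B\<close> by blast
  moreover have "inj_on (f \<circ> r) ?S"
    using inj' V.span_superset by (rule inj_on_subset)
  then have "card ((f \<circ> r) ` ?S) = card A"
    by (simp only: card_image inj_on_subset[OF inj_single_one] subset_UNIV)
  ultimately show ?thesis
    by (simp add: card_image inj_on_subset[OF inj_single_one])
qed

text \<open>The inverse inherits additivity and homogeneity, so the inequality applies in both
  directions.\<close>

lemma card_eq_of_linear_bij_supported_on:
  fixes f :: "('a \<Rightarrow>\<^sub>0 'k::field) \<Rightarrow> ('b \<Rightarrow>\<^sub>0 'k)"
  assumes "finite A" "finite B"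
    and bij: "bij_betw f (supported_on A) (supported_on B)"
    and add: "\<And>p q. p \<in> supported_on A \<Longrightarrow> q \<in> supported_on A \<Longrightarrow> f (p + q) = f p + f q"
    and scale: "\<And>c p. p \<in> supported_on A \<Longrightarrow> f (pscale c p) = pscale c (f p)"
  shows "card A = card B"
proof (rule antisym)
  have inj: "inj_on f (supported_on A)" and im: "f ` supported_on A = supported_on B"
    using bij by (auto simp: bij_betw_def)
  show "card A \<le> card B"
    using card_le_of_injective_on_supported_on[OF \<open>finite B\<close> inj _ add scale] im by blast
  let ?g = "inv_into (supported_on A) f"
  have g: "?g q \<in> supported_on A" "f (?g q) = q" if "q \<in> supported_on B" for q
    using that inv_into_into[of q f "supported_on A"] f_inv_into_f[of q f "supported_on A"]
    by (auto simp: im)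
  have gI: "?g (f p) = p" if "p \<in> supported_on A" for p
    using that inj by (rule inv_into_f_f[rotated])
  show "card B \<le> card A"
  proof (rule card_le_of_injective_on_supported_on[OF \<open>finite A\<close>])
    show "inj_on ?g (supported_on B)" by (simp add: im inj_on_inv_into)
    show "?g ` supported_on B \<subseteq> supported_on A" using g by blast
    show "?g (p + q) = ?g p + ?g q" if "p \<in> supported_on B" "q \<in> supported_on B" for p q
      using that by (metis add g gI supported_on_add)
    show "?g (pscale c p) = pscale c (?g p)" if "p \<in> supported_on B" for c p
      using that by (metis scale g gI supported_on_pscale)
  qed
qed

section \<open>Pulling back coefficients along bijections, and currying\<close>

text \<open>Pullback of coefficients along \<open>g\<close>, so the direction is reversed: a
  bijection from \<open>B\<close> to \<open>A\<close> carries functions on \<open>A\<close> to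
  functions on \<open>B\<close>. The cut-off outside \<open>B\<close> lets injectivity on
  \<open>B\<close> alone keep the support finite.\<close>

definition transport :: "'b set \<Rightarrow> ('b \<Rightarrow> 'a) \<Rightarrow> ('a \<Rightarrow>\<^sub>0 'k::zero) \<Rightarrow> ('b \<Rightarrow>\<^sub>0 'k)" where
  "transport B g p = Poly_Mapping.Abs_poly_mapping (\<lambda>x. if x \<in> B then Poly_Mapping.lookup p (g x) else 0)"

lemma lookup_transport:
  assumes "inj_on g B"
  shows "Poly_Mapping.lookup (transport B g p) x = (if x \<in> B then Poly_Mapping.lookup p (g x) else 0)"
proof -
  have "{x. (if x \<in> B then Poly_Mapping.lookup p (g x) else 0) \<noteq> 0}
      = {x \<in> B. g x \<in> Poly_Mapping.keys p}"
    by (auto simp: in_keys_iff)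
  moreover have "finite {x \<in> B. g x \<in> Poly_Mapping.keys p}"
  proof (rule finite_imageD)
    show "finite (g ` {x \<in> B. g x \<in> Poly_Mapping.keys p})"
      by (rule finite_subset[OF _ finite_keys[of p]]) auto
    show "inj_on g {x \<in> B. g x \<in> Poly_Mapping.keys p}"
      using assms by (rule inj_on_subset) auto
  qed
  ultimately show ?thesis by (simp add: transport_def)
qed

lemma transport_image:
  assumes "bij_betw g B A"
  shows "transport B g ` supported_on A = supported_on B"
proof (intro equalityI subsetI)
  have inj: "inj_on g B" using assms by (auto simp: bij_betw_def)
  fix q :: "'a \<Rightarrow>\<^sub>0 'c"
  assume "q \<in> transport B g ` supported_on A"
  then show "q \<in> supported_on B"
    by (auto intro!: supported_onI simp: lookup_transport[OF inj] split: if_splits)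
next
  have inj: "inj_on g B" using assms by (auto simp: bij_betw_def)
  let ?h = "inv_into B g"
  have h: "bij_betw ?h A B" by (rule bij_betw_inv_into[OF assms])
  then have inj_h: "inj_on ?h A" by (auto simp: bij_betw_def)
  fix q :: "'a \<Rightarrow>\<^sub>0 'c" assume q: "q \<in> supported_on B"
  have "q = transport B g (transport A ?h q)"
    using assms q
    by (intro poly_mapping_eqI)
      (auto simp: lookup_transport[OF inj] lookup_transport[OF inj_h] bij_betw_def lookup_supported_on)
  moreover have "transport A ?h q \<in> supported_on A"
    by (auto intro!: supported_onI simp: lookup_transport[OF inj_h] split: if_splits)
  ultimately show "q \<in> transport B g ` supported_on A" by blast
qed

lemma transport_inj:
  assumes "bij_betw g B A"
  shows "inj_on (transport B g) (supported_on A)"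
proof (rule inj_onI)
  have inj: "inj_on g B" using assms by (auto simp: bij_betw_def)
  fix p q :: "'b \<Rightarrow>\<^sub>0 'c"
  assume p: "p \<in> supported_on A" and q: "q \<in> supported_on A"
    and eq: "transport B g p = transport B g q"
  show "p = q"
  proof (rule poly_mapping_eqI)
    fix x
    show "Poly_Mapping.lookup p x = Poly_Mapping.lookup q x"
    proof (cases "x \<in> A")
      case True
      then obtain y where "y \<in> B" "x = g y" using assms by (auto simp: bij_betw_def)
      then show ?thesis
        using arg_cong[OF eq, of "\<lambda>r. Poly_Mapping.lookup r y"] by (simp add: lookup_transport[OF inj])
    next
      case False
      then show ?thesis using p q by (simp add: lookup_supported_on)
    qed
  qed
qed

text \<open>Reads a family of polynomials as one coefficient function on pairs of a summand number
  and a monomial. A direct sum thereby takes the form \<open>supported_on\<close>.\<close>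

definition uncurry_pm :: "('a \<Rightarrow>\<^sub>0 ('b \<Rightarrow>\<^sub>0 'k::zero)) \<Rightarrow> (('a \<times> 'b) \<Rightarrow>\<^sub>0 'k)" where
  "uncurry_pm f = Poly_Mapping.Abs_poly_mapping (\<lambda>(i, u). Poly_Mapping.lookup (Poly_Mapping.lookup f i) u)"

definition curry_pm :: "(('a \<times> 'b) \<Rightarrow>\<^sub>0 'k::zero) \<Rightarrow> ('a \<Rightarrow>\<^sub>0 ('b \<Rightarrow>\<^sub>0 'k))" where
  "curry_pm q = Poly_Mapping.Abs_poly_mapping
     (\<lambda>i. Poly_Mapping.Abs_poly_mapping (\<lambda>u. Poly_Mapping.lookup q (i, u)))"

lemma lookup_uncurry_pm [simp]:
  "Poly_Mapping.lookup (uncurry_pm f) (i, u) = Poly_Mapping.lookup (Poly_Mapping.lookup f i) u"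
proof -
  have "finite {x. (case x of (i, u) \<Rightarrow> Poly_Mapping.lookup (Poly_Mapping.lookup f i) u) \<noteq> 0}"
    by (rule finite_subset[of _ "Sigma (Poly_Mapping.keys f) (\<lambda>i. Poly_Mapping.keys (Poly_Mapping.lookup f i))"])
      (auto simp: in_keys_iff)
  then show ?thesis by (simp add: uncurry_pm_def)
qed

lemma lookup_curry_pm [simp]:
  "Poly_Mapping.lookup (Poly_Mapping.lookup (curry_pm q) i) u = Poly_Mapping.lookup q (i, u)"
proof -
  have fin: "finite {u. Poly_Mapping.lookup q (i, u) \<noteq> 0}" for i
    by (rule finite_subset[of _ "snd ` Poly_Mapping.keys q"]) (force simp: in_keys_iff)+
  have inner: "Poly_Mapping.lookup (Poly_Mapping.Abs_poly_mapping (\<lambda>u. Poly_Mapping.lookup q (i, u))) u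
      = Poly_Mapping.lookup q (i, u)" for i u
    using fin by simp
  have "finite {i. Poly_Mapping.Abs_poly_mapping (\<lambda>u. Poly_Mapping.lookup q (i, u)) \<noteq> 0}"
  proof (rule finite_subset[of _ "fst ` Poly_Mapping.keys q"])
    show "{i. Poly_Mapping.Abs_poly_mapping (\<lambda>u. Poly_Mapping.lookup q (i, u)) \<noteq> 0}
        \<subseteq> fst ` Poly_Mapping.keys q"
    proof
      fix i assume "i \<in> {i. Poly_Mapping.Abs_poly_mapping (\<lambda>u. Poly_Mapping.lookup q (i, u)) \<noteq> 0}"
      then obtain u where "Poly_Mapping.lookup q (i, u) \<noteq> 0"
        using inner by (metis (mono_tags, lifting) lookup_zero mem_Collect_eq poly_mapping_eqI)
      then show "i \<in> fst ` Poly_Mapping.keys q" by (force simp: in_keys_iff)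
    qed
  qed simp
  then show ?thesis by (simp add: curry_pm_def inner)
qed

lemma uncurry_curry_pm [simp]: "uncurry_pm (curry_pm q) = q"
  by (rule poly_mapping_eqI) (metis lookup_curry_pm lookup_uncurry_pm surj_pair)

lemma curry_uncurry_pm [simp]: "curry_pm (uncurry_pm f) = f"
  by (intro poly_mapping_eqI) simp

section \<open>Monomials of given degree and their generating series\<close>

lemma mdeg_eq_sum:
  assumes "finite S" "Poly_Mapping.keys u \<subseteq> S"
  shows "mdeg u = (\<Sum>i\<in>S. Poly_Mapping.lookup u i)"
  unfolding mdeg_def using assms by (intro sum.mono_neutral_left) (auto simp: in_keys_iff)

lemma mdeg_add [simp]: "mdeg (u + v) = mdeg u + mdeg v"
proof -
  let ?S = "Poly_Mapping.keys u \<union> Poly_Mapping.keys v"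
  show ?thesis
    using keys_add[of u v] by (simp add: mdeg_eq_sum[of ?S] lookup_add sum.distrib)
qed

lemma mdeg_single [simp]: "mdeg (Poly_Mapping.single i c) = c"
  by (simp add: mdeg_def)

lemma monomials_in_add:
  "u + v \<in> monomials_in Z \<longleftrightarrow> u \<in> monomials_in Z \<and> v \<in> monomials_in Z"
  by (auto simp: monomials_in_def in_keys_iff lookup_add subset_iff)

lemma monomials_in_mono: "Z \<subseteq> Z' \<Longrightarrow> monomials_in Z \<subseteq> monomials_in Z'"
  by (auto simp: monomials_in_def)

lemma monomials_in_single [simp]:
  "Poly_Mapping.single i c \<in> monomials_in Z \<longleftrightarrow> c = 0 \<or> i \<in> Z"
  by (auto simp: monomials_in_def)

lemma lookup_monomials_in:
  "u \<in> monomials_in Z \<Longrightarrow> i \<notin> Z \<Longrightarrow> Poly_Mapping.lookup u i = 0"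
  by (auto simp: monomials_in_def in_keys_iff)

lemma exponent_eq_single_add:
  assumes "Poly_Mapping.lookup u i \<noteq> (0::nat)"
  obtains v where "u = Poly_Mapping.single i 1 + v"
proof
  show "u = Poly_Mapping.single i 1 + (u - Poly_Mapping.single i 1)"
    using assms by (intro poly_mapping_eqI) (auto simp: lookup_add lookup_minus lookup_single when_def)
qed

text \<open>Either z does not divide \<open>u\<close>, or one factor z can be removed. This
  recursion drives both the finiteness of the degree pieces and the Hilbert series of a polynomial
  ring.\<close>

lemma monomials_in_insert_Suc:
  assumes "z \<notin> Z"
  shows "{u \<in> monomials_in (insert z Z). mdeg u = Suc k} =
    {u \<in> monomials_in Z. mdeg u = Suc k} \<union>
    (+) (Poly_Mapping.single z 1) ` {u \<in> monomials_in (insert z Z). mdeg u = k}" (is "?L = ?R")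
proof (intro equalityI subsetI)
  fix u assume u: "u \<in> ?L"
  show "u \<in> ?R"
  proof (cases "Poly_Mapping.lookup u z = 0")
    case True
    then have "u \<in> monomials_in Z"
      using u unfolding monomials_in_def by (metis (mono_tags, lifting) True in_keys_iff
          insertE mem_Collect_eq subset_iff)
    then show ?thesis using u by simp
  next
    case False
    then obtain v where "u = Poly_Mapping.single z 1 + v"
      by (rule exponent_eq_single_add)
    then show ?thesis using u by (auto simp: monomials_in_add)
  qed
next
  fix u assume "u \<in> ?R"
  then show "u \<in> ?L"
    using monomials_in_mono[of Z "insert z Z"] by (auto simp: monomials_in_add)
qed

lemma monomials_in_degree_0: "{u \<in> monomials_in Z. mdeg u = 0} = {0}"
proof -
  have "u = 0" if "mdeg u = 0" for u
    using that by (intro poly_mapping_eqI) (auto simp: mdeg_def in_keys_iff)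
  then show ?thesis by (auto simp: monomials_in_def mdeg_def)
qed

lemma finite_monomials_in_degree:
  assumes "finite Z"
  shows "finite {u \<in> monomials_in Z. mdeg u = k}"
  using assms
proof (induction Z arbitrary: k rule: finite_induct)
  case empty
  then show ?case by (simp add: monomials_in_def)
next
  case (insert z Z)
  show ?case
    by (induction k) (simp_all add: monomials_in_degree_0 monomials_in_insert_Suc insert)
qed

definition monomial_series :: "(nat \<Rightarrow>\<^sub>0 nat) set \<Rightarrow> int fps" where
  "monomial_series B = Abs_fps (\<lambda>k. int (card {u \<in> B. mdeg u = k}))"

text \<open>The series 1/(1 - t). Over the integers, division is replaced by the identities
  \<open>geom_eq\<close> and \<open>geom_inverse\<close>.\<close>

definition geom :: "int fps" where
  "geom = Abs_fps (\<lambda>_. 1)"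

lemma geom_nth [simp]: "geom $ k = 1"
  by (simp add: geom_def)

lemma geom_eq: "geom = 1 + fps_X * geom"
  by (rule fps_ext) (simp add: fps_mult_fps_X_plus_1_nth)

text \<open>Splitting by divisibility by z gives H(Z + z) = H(Z) + t H(Z + z), hence one factor 1/(1
  - t) for each variable.\<close>

lemma monomial_series_monomials_in:
  assumes "finite Z"
  shows "monomial_series (monomials_in Z) = geom ^ card Z"
  using assms
proof (induction Z rule: finite_induct)
  case empty
  have "{u \<in> monomials_in {}. mdeg u = k} = (if k = 0 then {0} else {})" for k
    by (auto simp: monomials_in_def mdeg_def)
  then show ?case by (auto simp: monomial_series_def intro!: fps_ext)
next
  case (insert z Z)
  let ?A = "\<lambda>Z. monomial_series (monomials_in Z)"
  have step: "?A (insert z Z) $ Suc k = ?A Z $ Suc k + ?A (insert z Z) $ k" for k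
  proof -
    have disj: "{u \<in> monomials_in Z. mdeg u = Suc k} \<inter>
        (+) (Poly_Mapping.single z 1) ` {u \<in> monomials_in (insert z Z). mdeg u = k} = {}"
      using insert.hyps(2) by (auto simp: monomials_in_add)
    have "inj_on ((+) (Poly_Mapping.single z (1::nat))) S" for S
      by (rule inj_onI) simp
    then show ?thesis
      using insert.hyps disj
      by (simp add: monomial_series_def monomials_in_insert_Suc card_Un_disjoint
          finite_monomials_in_degree card_image)
  qed
  have "?A (insert z Z) = ?A Z + fps_X * ?A (insert z Z)"
  proof (rule fps_ext)
    fix k show "?A (insert z Z) $ k = (?A Z + fps_X * ?A (insert z Z)) $ k"
      by (cases k) (simp_all add: step, simp add: monomial_series_def monomials_in_degree_0)
  qed
  then have 1: "?A (insert z Z) * (1 - fps_X) = ?A Z" by (simp add: algebra_simps)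
  have 2: "geom * (1 - fps_X) = 1" using geom_eq by (simp add: algebra_simps)
  have "?A (insert z Z) = (geom * (1 - fps_X)) * ?A (insert z Z)" by (simp add: 2)
  also have "\<dots> = geom * (?A (insert z Z) * (1 - fps_X))" by (simp add: algebra_simps)
  also have "\<dots> = geom ^ card (insert z Z)" using insert by (simp add: 1)
  finally show ?case .
qed

section \<open>Hilbert decompositions as identities of power series\<close>

definition decomposition_series :: "(nat set \<times> nat) list \<Rightarrow> int fps" where
  "decomposition_series D = (\<Sum>(Z, s)\<leftarrow>D. fps_X ^ s * geom ^ card Z)"

text \<open>The pair \<open>(i, u)\<close> stands for the family with the monomial \<open>u\<close>
  in place \<open>i\<close> and 0 elsewhere; \<open>shifted_degree\<close> is its degree in the
  shifted direct sum.\<close>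

definition direct_sum_basis :: "(nat set \<times> nat) list \<Rightarrow> (nat \<times> (nat \<Rightarrow>\<^sub>0 nat)) set" where
  "direct_sum_basis D = {(i, u). i < length D \<and> u \<in> monomials_in (fst (D ! i))}"

definition shifted_degree :: "(nat set \<times> nat) list \<Rightarrow> nat \<times> (nat \<Rightarrow>\<^sub>0 nat) \<Rightarrow> nat" where
  "shifted_degree D x = snd (D ! fst x) + mdeg (snd x)"

lemma supported_on_iff:
  "p \<in> supported_on A \<longleftrightarrow> (\<forall>x. Poly_Mapping.lookup p x \<noteq> 0 \<longrightarrow> x \<in> A)"
  by (auto simp: supported_on_def in_keys_iff)

lemma direct_sum_iff: "f \<in> direct_sum D \<longleftrightarrow> uncurry_pm f \<in> supported_on (direct_sum_basis D)"
proof -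
  have "Poly_Mapping.keys f \<subseteq> {..<length D} \<longleftrightarrow>
      (\<forall>i u. Poly_Mapping.lookup (Poly_Mapping.lookup f i) u \<noteq> 0 \<longrightarrow> i < length D)"
    by (auto simp: subset_iff in_keys_iff) (metis lookup_zero poly_mapping_eqI)+
  then show ?thesis
    by (auto simp: direct_sum_def polys_in_eq supported_on_iff direct_sum_basis_def)
qed

lemma graded_part_supported_on:
  "graded_part (supported_on B) k = supported_on {u \<in> B. mdeg u = k}"
  by (auto simp: graded_part_def supported_on_def homogeneous_def)

text \<open>Writing the degree condition as \<open>s + mdeg u = k\<close> avoids truncated
  subtraction: for \<open>k < s\<close> no monomial satisfies it, and both sides are
  \<open>{0}\<close>.\<close>

lemma shifted_part_eq:
  "shifted_part Z s k = supported_on {u \<in> monomials_in Z. s + mdeg u = k}"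
proof (cases "s \<le> k")
  case True
  then have "{u \<in> monomials_in Z. mdeg u = k - s} = {u \<in> monomials_in Z. s + mdeg u = k}" by auto
  with True show ?thesis
    by (simp add: shifted_part_def polys_in_eq graded_part_supported_on)
next
  case False
  then have "{u \<in> monomials_in Z. s + mdeg u = k} = {}" by auto
  with False show ?thesis
    by (simp add: shifted_part_def supported_on_def)
qed

lemma direct_sum_part_iff:
  "f \<in> direct_sum_part D k \<longleftrightarrow>
     uncurry_pm f \<in> supported_on {x \<in> direct_sum_basis D. shifted_degree D x = k}"
  unfolding direct_sum_part_def mem_Collect_eq direct_sum_iff
  by (auto simp: shifted_part_eq supported_on_iff direct_sum_basis_def shifted_degree_def)

lemma uncurry_pm_image_eqI:
  assumes "\<And>f. f \<in> S \<longleftrightarrow> uncurry_pm f \<in> T"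
  shows "uncurry_pm ` S = T"
  using assms by (metis (mono_tags, lifting) image_eqI image_iff subsetI subset_antisym uncurry_curry_pm)

lemma uncurry_direct_sum: "uncurry_pm ` direct_sum D = supported_on (direct_sum_basis D)"
  by (rule uncurry_pm_image_eqI) (rule direct_sum_iff)

lemma uncurry_direct_sum_part:
  "uncurry_pm ` direct_sum_part D k =
     supported_on {x \<in> direct_sum_basis D. shifted_degree D x = k}"
  by (rule uncurry_pm_image_eqI) (rule direct_sum_part_iff)

lemma inj_uncurry_pm: "inj uncurry_pm"
  by (metis curry_uncurry_pm injI)

lemma uncurry_pm_add: "uncurry_pm (f + g) = uncurry_pm f + uncurry_pm g"
proof (rule poly_mapping_eqI)
  fix x show "Poly_Mapping.lookup (uncurry_pm (f + g)) x = Poly_Mapping.lookup (uncurry_pm f + uncurry_pm g) x"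
    by (cases x) (simp add: lookup_add)
qed

lemma uncurry_pm_scale:
  "uncurry_pm (Poly_Mapping.map (mscale c) f) = pscale c (uncurry_pm f)"
proof (rule poly_mapping_eqI)
  fix x show "Poly_Mapping.lookup (uncurry_pm (Poly_Mapping.map (mscale c) f)) x
      = Poly_Mapping.lookup (pscale c (uncurry_pm f)) x"
    by (cases x) (simp add: map.rep_eq when_def mscale_eq_pscale)
qed

lemma direct_sum_basis_degree_eq:
  "{x \<in> direct_sum_basis D. shifted_degree D x = k} =
     Sigma {..<length D} (\<lambda>i. {u \<in> monomials_in (fst (D ! i)). snd (D ! i) + mdeg u = k})"
  by (auto simp: direct_sum_basis_def shifted_degree_def)

lemma card_shifted_monomials:
  assumes "finite Z"
  shows "finite {u \<in> monomials_in Z. s + mdeg u = k}"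
    and "int (card {u \<in> monomials_in Z. s + mdeg u = k}) = (fps_X ^ s * geom ^ card Z) $ k"
proof -
  have *: "{u \<in> monomials_in Z. s + mdeg u = k} =
      (if s \<le> k then {u \<in> monomials_in Z. mdeg u = k - s} else {})" by auto
  show "finite {u \<in> monomials_in Z. s + mdeg u = k}"
    using assms by (simp add: * finite_monomials_in_degree)
  show "int (card {u \<in> monomials_in Z. s + mdeg u = k}) = (fps_X ^ s * geom ^ card Z) $ k"
    using arg_cong[OF monomial_series_monomials_in[OF assms], of "\<lambda>f. f $ (k - s)"]
    by (simp add: * fps_X_power_mult_nth monomial_series_def)
qed

lemma direct_sum_basis_degree:
  assumes "\<forall>(Z, s)\<in>set D. finite Z"
  shows "finite {x \<in> direct_sum_basis D. shifted_degree D x = k}"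
    and "int (card {x \<in> direct_sum_basis D. shifted_degree D x = k}) = decomposition_series D $ k"
proof -
  have fin: "finite (fst (D ! i))" if "i < length D" for i
    using assms nth_mem[OF that] by (auto simp: case_prod_beta)
  then show "finite {x \<in> direct_sum_basis D. shifted_degree D x = k}"
    unfolding direct_sum_basis_degree_eq by (intro finite_SigmaI) (auto intro: card_shifted_monomials)
  have "decomposition_series D = (\<Sum>i<length D. fps_X ^ snd (D ! i) * geom ^ card (fst (D ! i)))"
    by (simp add: decomposition_series_def sum_list_sum_nth atLeast0LessThan case_prod_beta)
  then show "int (card {x \<in> direct_sum_basis D. shifted_degree D x = k}) = decomposition_series D $ k"
    unfolding direct_sum_basis_degree_eq using fin
    by (subst card_SigmaI) (auto simp: card_shifted_monomials fps_sum_nth)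
qed

text \<open>In one direction, a graded isomorphism restricts in each degree to a linear bijection of
  finite-dimensional spaces. In the other, equal cardinalities give bijections of the bases degree
  by degree; they glue to a single \<open>g\<close>, and pulling back coefficients along
  \<open>g\<close> is a graded isomorphism.\<close>

lemma graded_iso_iff_card_eq:
  assumes B: "\<And>k. finite {u \<in> B. mdeg u = k}"
    and D: "\<And>k. finite {x \<in> direct_sum_basis D. shifted_degree D x = k}"
  shows "(\<exists>\<phi>. graded_iso (supported_on B :: 'k::field mpoly set) D \<phi>) \<longleftrightarrow>
    (\<forall>k. card {u \<in> B. mdeg u = k} = card {x \<in> direct_sum_basis D. shifted_degree D x = k})"
    (is "?iso \<longleftrightarrow> (\<forall>k. card (?B k) = card (?P k))")
proof
  assume ?iso
  then obtain \<phi> where \<phi>: "graded_iso (supported_on B :: 'k mpoly set) D \<phi>" ..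
  have bij: "bij_betw \<phi> (supported_on B) (direct_sum D)"
    and add: "\<And>p q. p \<in> supported_on B \<Longrightarrow> q \<in> supported_on B \<Longrightarrow> \<phi> (p + q) = \<phi> p + \<phi> q"
    and scale: "\<And>c p. p \<in> supported_on B \<Longrightarrow> \<phi> (mscale c p) = Poly_Mapping.map (mscale c) (\<phi> p)"
    and part: "\<And>k. \<phi> ` supported_on (?B k) = direct_sum_part D k"
    using \<phi> by (simp_all add: graded_iso_def graded_part_supported_on)
  show "\<forall>k. card (?B k) = card (?P k)"
  proof
    fix k
    have sub: "p \<in> supported_on B" if "p \<in> supported_on (?B k)" for p :: "'k mpoly"
      using that by (auto simp: supported_on_def)
    show "card (?B k) = card (?P k)"
    proof (rule card_eq_of_linear_bij_supported_on[OF B D])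
      have "inj_on \<phi> (supported_on (?B k))"
        using bij sub by (auto simp: bij_betw_def inj_on_def)
      then show "bij_betw (uncurry_pm \<circ> \<phi>) (supported_on (?B k)) (supported_on (?P k))"
        unfolding bij_betw_def
        by (simp only: comp_inj_on inj_on_subset[OF inj_uncurry_pm] subset_UNIV
            image_comp[symmetric] part uncurry_direct_sum_part simp_thms)
    qed (auto simp: sub add scale uncurry_pm_add uncurry_pm_scale simp flip: mscale_eq_pscale)
  qed
next
  assume card: "\<forall>k. card (?B k) = card (?P k)"
  let ?P' = "direct_sum_basis D"
  have "\<forall>k. \<exists>h. bij_betw h (?P k) (?B k)"
    using card B D by (auto intro!: finite_same_card_bij)
  from choice[OF this] obtain h where h: "\<And>k. bij_betw (h k) (?P k) (?B k)" by blast
  \<comment> \<open>The degree pieces are disjoint, so the chosen bijections combine into one map on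
    the whole basis.\<close>
  define g where "g x = h (shifted_degree D x) x" for x
  have gk: "bij_betw g (?P k) (?B k)" for k
    using h[of k] by (rule iffD1[OF bij_betw_cong, rotated]) (simp add: g_def)
  have g_deg: "g x \<in> B" "mdeg (g x) = shifted_degree D x" if "x \<in> ?P'" for x
    using bij_betw_apply[OF gk[of "shifted_degree D x"], of x] that by auto
  have g: "bij_betw g ?P' B"
    unfolding bij_betw_def
  proof (intro conjI inj_onI equalityI subsetI)
    fix x y assume *: "x \<in> ?P'" "y \<in> ?P'" "g x = g y"
    then have "shifted_degree D x = shifted_degree D y" by (metis g_deg(2))
    then show "x = y"
      using * inj_onD[OF bij_betw_imp_inj_on[OF gk], of x y "shifted_degree D x"] by simp
  next
    fix u assume "u \<in> B"
    then have "u \<in> g ` ?P (mdeg u)" using gk[of "mdeg u"] by (auto simp: bij_betw_def)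
    then show "u \<in> g ` ?P'" by auto
  qed (use g_deg in auto)
  then have inj: "inj_on g ?P'" by (auto simp: bij_betw_def)
  define \<phi> :: "'k mpoly \<Rightarrow> _" where "\<phi> p = curry_pm (transport ?P' g p)" for p
  have uncurry: "uncurry_pm (\<phi> p) = transport ?P' g p" for p by (simp add: \<phi>_def)
  have image_eqI: "\<phi> ` S = T" if "transport ?P' g ` S = uncurry_pm ` T" for S T
  proof -
    have "uncurry_pm ` \<phi> ` S = uncurry_pm ` T"
      using that by (simp add: image_image uncurry)
    then show ?thesis by (simp add: inj_image_eq_iff[OF inj_uncurry_pm])
  qed
  have "graded_iso (supported_on B) D \<phi>"
    unfolding graded_iso_def graded_part_supported_on
  proof (intro conjI ballI allI)
    have "inj_on \<phi> (supported_on B)"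
      using transport_inj[OF g] unfolding inj_on_def by (metis uncurry)
    moreover have "\<phi> ` supported_on B = direct_sum D"
      by (rule image_eqI) (simp add: transport_image[OF g] uncurry_direct_sum)
    ultimately show "bij_betw \<phi> (supported_on B) (direct_sum D)" by (simp add: bij_betw_def)
  next
    fix p q :: "'k mpoly"
    have "uncurry_pm (\<phi> (p + q)) = uncurry_pm (\<phi> p + \<phi> q)"
      unfolding uncurry_pm_add uncurry
      by (intro poly_mapping_eqI) (simp add: lookup_add lookup_transport[OF inj])
    then show "\<phi> (p + q) = \<phi> p + \<phi> q" by (rule injD[OF inj_uncurry_pm])
  next
    fix c and p :: "'k mpoly"
    have "uncurry_pm (\<phi> (mscale c p)) = uncurry_pm (Poly_Mapping.map (mscale c) (\<phi> p))"
      unfolding uncurry_pm_scale uncurry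
      by (intro poly_mapping_eqI) (simp add: mscale_eq_pscale lookup_transport[OF inj])
    then show "\<phi> (mscale c p) = Poly_Mapping.map (mscale c) (\<phi> p)" by (rule injD[OF inj_uncurry_pm])
  next
    fix k
    have inj_k: "inj_on g (?P k)" using gk by (auto simp: bij_betw_def)
    \<comment> \<open>\<open>g\<close> preserves degrees, so a polynomial supported in degree
      \<open>k\<close> pulls back to 0 outside \<open>?P k\<close>.\<close>
    have "transport ?P' g p = transport (?P k) g p" if "p \<in> supported_on (?B k)" for p :: "'k mpoly"
      using that g_deg(2)
      by (intro poly_mapping_eqI)
        (auto simp: lookup_transport[OF inj] lookup_transport[OF inj_k] lookup_supported_on)
    then have "transport ?P' g ` supported_on (?B k)
        = (transport (?P k) g ` supported_on (?B k) :: (_ \<Rightarrow>\<^sub>0 'k) set)"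
      by (rule image_cong[OF refl])
    then show "\<phi> ` supported_on (?B k) = direct_sum_part D k"
      by (intro image_eqI) (simp add: transport_image[OF gk] uncurry_direct_sum_part)
  qed
  then show ?iso by blast
qed

text \<open>From here on neither the field nor the isomorphism matters: the existence of a
  decomposition is an identity in \<open>int fps\<close>, in which each Z enters only through its
  size.\<close>

lemma hilbert_decomposition_iff_series:
  assumes B: "B \<subseteq> monomials_in {1..n}"
  shows "is_hilbert_decomposition n (supported_on B :: 'k::field mpoly set) D \<longleftrightarrow>
    (\<forall>(Z, s)\<in>set D. Z \<subseteq> {1..n}) \<and> monomial_series B = decomposition_series D"
proof (cases "\<forall>(Z, s)\<in>set D. Z \<subseteq> {1..n}")
  case True
  then have fin: "\<forall>(Z, s)\<in>set D. finite Z" by (auto dest!: bspec intro: finite_subset)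
  have "finite {u \<in> B. mdeg u = k}" for k
    using B by (intro finite_subset[OF _ finite_monomials_in_degree[of "{1..n}" k]]) auto
  then show ?thesis
    using True direct_sum_basis_degree(1)[OF fin]
    by (simp flip: direct_sum_basis_degree(2)[OF fin] add: is_hilbert_decomposition_def graded_iso_iff_card_eq fps_eq_iff monomial_series_def)
next
  case False
  then show ?thesis by (auto simp: is_hilbert_decomposition_def)
qed

lemma hilbert_series_supported_on:
  "hilbert_series (supported_on B :: 'k::field mpoly set) = monomial_series B"
  by (simp add: hilbert_series_def graded_part_supported_on monomial_series_def
      mscale_eq_pscale dim_supported_on)

section \<open>Monomial ideals as spans of monomials\<close>

definition monomial_multiples :: "nat \<Rightarrow> (nat \<Rightarrow>\<^sub>0 nat) set \<Rightarrow> (nat \<Rightarrow>\<^sub>0 nat) set" where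
  "monomial_multiples n M = {g + w | g w. g \<in> M \<and> w \<in> monomials_in {1..n}}"

lemma monomial_multiples_Un:
  "monomial_multiples n (M \<union> M') = monomial_multiples n M \<union> monomial_multiples n M'"
  by (auto simp: monomial_multiples_def)

lemma monomial_multiples_subset:
  "M \<subseteq> monomials_in {1..n} \<Longrightarrow> monomial_multiples n M \<subseteq> monomials_in {1..n}"
  by (auto simp: monomial_multiples_def monomials_in_add)

lemma monomial_multiplesI:
  assumes "g \<in> M" "u \<in> monomials_in {1..n}"
    and "\<And>i. Poly_Mapping.lookup g i \<le> Poly_Mapping.lookup u i"
  shows "u \<in> monomial_multiples n M"
proof -
  have "u = g + (u - g)"
    using assms(3) by (intro poly_mapping_eqI) (simp add: lookup_add lookup_minus)
  then show ?thesis
    using assms(1,2) monomials_in_add[of g "u - g"] unfolding monomial_multiples_def by auto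
qed

lemma monomial_in_supported_on [simp]:
  "(monomial u :: 'k::field mpoly) \<in> supported_on B \<longleftrightarrow> u \<in> B"
  by (simp add: monomial_def supported_on_def)

lemma ideal_supported_on:
  assumes B: "B \<subseteq> monomials_in {1..n}"
    and mult: "\<And>u w. u \<in> B \<Longrightarrow> w \<in> monomials_in {1..n} \<Longrightarrow> u + w \<in> B"
  shows "ideal (supported_on B) (poly_ring n :: 'k::field mpoly ring)"
proof -
  interpret R: cring "poly_ring n :: 'k mpoly ring" by (rule cring_poly_ring)
  let ?R = "poly_ring n :: 'k mpoly ring"
  have carrier: "carrier ?R = supported_on (monomials_in {1..n})"
    by (simp add: poly_ring_def polys_in_eq)
  have sub: "supported_on B \<subseteq> carrier ?R"
    using B unfolding carrier by (auto simp: supported_on_def)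
  have prod: "p * q \<in> supported_on B" if "p \<in> supported_on B" "q \<in> carrier ?R" for p q
    using that keys_mult[of p q] mult unfolding carrier supported_on_def by fastforce
  show ?thesis
  proof (rule idealI[OF R.ring_axioms])
    have uminus: "\<ominus>\<^bsub>?R\<^esub> p = - p" if "p \<in> carrier ?R" for p :: "'k mpoly"
    proof (rule R.minus_equality)
      show "- p \<in> carrier ?R" "p \<in> carrier ?R"
        using that by (auto simp: carrier supported_on_def)
    qed (simp add: poly_ring_def)
    show "subgroup (supported_on B) (add_monoid ?R)"
    proof
      fix p :: "'k mpoly" assume p: "p \<in> supported_on B"
      then have "\<ominus>\<^bsub>?R\<^esub> p = - p" using sub by (intro uminus) blast
      then show "inv\<^bsub>add_monoid ?R\<^esub> p \<in> supported_on B"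
        using p by (simp add: a_inv_def supported_on_def)
    qed (use sub in \<open>auto simp: poly_ring_def supported_on_add, auto simp: supported_on_def\<close>)
  next
    fix p q :: "'k mpoly" assume "p \<in> supported_on B" "q \<in> carrier ?R"
    then show "p \<otimes>\<^bsub>?R\<^esub> q \<in> supported_on B" "q \<otimes>\<^bsub>?R\<^esub> p \<in> supported_on B"
      using prod[of p q] by (auto simp: poly_ring_def mult.commute)
  qed
qed

text \<open>The right side is an ideal containing the generators, which gives one inclusion.
  Conversely, a scaled monomial with exponent \<open>g + w\<close> is the product of the generator
  with exponent \<open>g\<close> and a scaled monomial with exponent \<open>w\<close>, and every
  element of the right side is a finite sum of such products.\<close>

lemma ideal_gen_monomials:
  assumes M: "M \<subseteq> monomials_in {1..n}"
  shows "ideal_gen n (monomial ` M :: 'k::field mpoly set) = supported_on (monomial_multiples n M)"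
proof
  interpret R: cring "poly_ring n :: 'k mpoly ring" by (rule cring_poly_ring)
  let ?J = "ideal_gen n (monomial ` M :: 'k mpoly set)"
  have gens: "monomial ` M \<subseteq> carrier (poly_ring n :: 'k mpoly ring)"
    using M by (auto simp: poly_ring_def polys_in_eq)
  show "?J \<subseteq> supported_on (monomial_multiples n M)"
    unfolding ideal_gen_def
  proof (rule R.genideal_minimal[OF ideal_supported_on[OF monomial_multiples_subset[OF M]]])
    show "u + w \<in> monomial_multiples n M"
      if u: "u \<in> monomial_multiples n M" and w: "w \<in> monomials_in {1..n}" for u w
    proof -
      obtain g v where "u = g + v" "g \<in> M" "v \<in> monomials_in {1..n}"
        using u unfolding monomial_multiples_def by blast
      then have "u + w = g + (v + w)" "v + w \<in> monomials_in {1..n}"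
        using w by (simp_all add: add.assoc monomials_in_add)
      then show ?thesis using \<open>g \<in> M\<close> unfolding monomial_multiples_def by blast
    qed
    show "monomial ` M \<subseteq> (supported_on (monomial_multiples n M) :: 'k mpoly set)"
      using monomial_multiplesI[OF _ subsetD[OF M] order_refl] by auto
  qed
  interpret J: ideal ?J "poly_ring n :: 'k mpoly ring"
    unfolding ideal_gen_def by (rule R.genideal_ideal[OF gens])
  have add: "p + q \<in> ?J" if "p \<in> ?J" "q \<in> ?J" for p q
    using J.a_closed[OF that] by (simp add: poly_ring_def)
  have zero: "0 \<in> ?J" using J.zero_closed by (simp add: poly_ring_def)
  have scaled_monomial: "pscale c (Poly_Mapping.single u 1) \<in> ?J" if u_mult: "u \<in> monomial_multiples n M" for c u
  proof -
    obtain g w where u: "u = g + w" "g \<in> M" "w \<in> monomials_in {1..n}"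
      using u_mult unfolding monomial_multiples_def by blast
    have "monomial g \<in> ?J"
      using R.genideal_self[OF gens] u(2) by (auto simp: ideal_gen_def)
    moreover have "Poly_Mapping.single w c \<in> carrier (poly_ring n)"
      using u(3) by (simp add: poly_ring_def polys_in_def)
    ultimately have "Poly_Mapping.single w c * monomial g \<in> ?J"
      using J.I_l_closed by (simp add: poly_ring_def)
    moreover have "Poly_Mapping.single w c * monomial g = pscale c (Poly_Mapping.single u 1)"
      by (rule poly_mapping_eqI) (simp add: u(1) monomial_def mult_single lookup_single when_def add.commute)
    ultimately show ?thesis by simp
  qed
  show "supported_on (monomial_multiples n M) \<subseteq> ?J"
  proof
    fix p :: "'k mpoly" assume p: "p \<in> supported_on (monomial_multiples n M)"
    have "(\<Sum>u\<in>F. pscale (Poly_Mapping.lookup p u) (Poly_Mapping.single u 1)) \<in> ?J"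
      if "finite F" "F \<subseteq> monomial_multiples n M" for F
      using that by (induction F rule: finite_induct) (auto simp: zero intro!: add scaled_monomial)
    from this[of "Poly_Mapping.keys p"] show "p \<in> ?J"
      using p poly_mapping_eq_sum_singles[of "Poly_Mapping.keys p" p] by (simp add: supported_on_def)
  qed
qed

section \<open>Stanley decompositions into translates of polynomial subrings\<close>

lemma monomial_series_Un:
  assumes "B \<subseteq> monomials_in Z" "B' \<subseteq> monomials_in Z" "finite Z" "B \<inter> B' = {}"
  shows "monomial_series (B \<union> B') = monomial_series B + monomial_series B'"
proof -
  have fin: "finite {u \<in> A. mdeg u = k}" if "A \<subseteq> monomials_in Z" for A k
    using that by (intro finite_subset[OF _ finite_monomials_in_degree[OF \<open>finite Z\<close>, of k]]) auto
  have "{u \<in> B \<union> B'. mdeg u = k} = {u \<in> B. mdeg u = k} \<union> {u \<in> B'. mdeg u = k}" for k by auto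
  then have "card {u \<in> B \<union> B'. mdeg u = k} = card {u \<in> B. mdeg u = k} + card {u \<in> B'. mdeg u = k}" for k
    using assms by (simp only:) (rule card_Un_disjoint, auto simp: fin)
  then show ?thesis by (intro fps_ext) (simp add: monomial_series_def)
qed

lemma monomial_series_translate:
  assumes "finite Z"
  shows "monomial_series ((+) c ` monomials_in Z) = fps_X ^ mdeg c * geom ^ card Z"
proof (rule fps_ext)
  fix k
  have "{u \<in> (+) c ` monomials_in Z. mdeg u = k} = (+) c ` {u \<in> monomials_in Z. mdeg c + mdeg u = k}"
    by auto
  moreover have "inj_on ((+) c) S" for S by (rule inj_onI) simp
  ultimately show "monomial_series ((+) c ` monomials_in Z) $ k = (fps_X ^ mdeg c * geom ^ card Z) $ k"
    using card_shifted_monomials(2)[OF assms, of "mdeg c" k]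
    by (simp only: monomial_series_def fps_nth_Abs_fps card_image)
qed

text \<open>A Stanley decomposition: sorting the multiples of the \<open>c x\<^sub>j\<close> by the least variable
  \<open>x\<^sub>j\<close> of their cofactor of \<open>c\<close>.\<close>

lemma monomial_series_disjoint_translates:
  assumes "finite J" "finite Z'" "\<And>j. j \<in> J \<Longrightarrow> Z j \<subseteq> Z'"
    and "\<And>j. j \<in> J \<Longrightarrow> c + Poly_Mapping.single j 1 \<in> monomials_in Z'"
    and "\<And>i j. i \<in> J \<Longrightarrow> j \<in> J \<Longrightarrow> i < j \<Longrightarrow> i \<notin> Z j"
  shows "monomial_series (\<Union>j\<in>J. (+) (c + Poly_Mapping.single j 1) ` monomials_in (Z j)) =
    (\<Sum>j\<in>J. fps_X ^ (mdeg c + 1) * geom ^ card (Z j))"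
  using assms
proof (induction J rule: finite_induct)
  case empty
  then show ?case by (auto simp: monomial_series_def intro!: fps_ext)
next
  case (insert k J)
  let ?T = "\<lambda>j. (+) (c + Poly_Mapping.single j (1::nat)) ` monomials_in (Z j)"
  have ne: "?T i \<inter> ?T j = {}" if "i \<in> insert k J" "j \<in> insert k J" "i < j" for i j
  proof -
    \<comment> \<open>After cancelling \<open>c\<close>, the left side is divisible by x_i. The
      right side is not, because \<open>i\<close> is neither \<open>j\<close> nor an element of
      \<open>Z j\<close>.\<close>
    have False if "Poly_Mapping.single i 1 + v = Poly_Mapping.single j 1 + w"
      "w \<in> monomials_in (Z j)" for v w
    proof -
      have "Poly_Mapping.lookup w i = 0"
        using that(2) insert.prems(4)[OF \<open>i \<in> _\<close> \<open>j \<in> _\<close> \<open>i < j\<close>] by (rule lookup_monomials_in)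
      then show False
        using arg_cong[OF that(1), of "\<lambda>p. Poly_Mapping.lookup p i"] \<open>i < j\<close>
        by (simp add: lookup_add lookup_single)
    qed
    then show ?thesis by (auto simp: add.assoc)
  qed
  have "?T k \<inter> ?T j = {}" if "j \<in> J" for j
    using that ne[of k j] ne[of j k] insert.hyps(2) by (cases k j rule: linorder_cases) auto
  then have disj: "?T k \<inter> (\<Union>j\<in>J. ?T j) = {}" by blast
  have sub: "?T j \<subseteq> monomials_in Z'" if "j \<in> insert k J" for j
    using insert.prems(2,3)[OF that] monomials_in_mono[of "Z j" Z'] by (auto simp: monomials_in_add)
  have "monomial_series (?T k \<union> (\<Union>j\<in>J. ?T j)) = monomial_series (?T k) + monomial_series (\<Union>j\<in>J. ?T j)"
    using sub by (intro monomial_series_Un[OF _ _ insert.prems(1) disj] UN_least) blast+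
  moreover have "finite (Z k)"
    using insert.prems(1,2) finite_subset by blast
  then have "monomial_series (?T k) = fps_X ^ (mdeg c + 1) * geom ^ card (Z k)"
    by (simp add: monomial_series_translate)
  moreover have "monomial_series (\<Union>j\<in>J. ?T j) = (\<Sum>j\<in>J. fps_X ^ (mdeg c + 1) * geom ^ card (Z j))"
    by (rule insert.IH) (use insert.prems in auto)
  ultimately show ?case by (simp only: UN_insert sum.insert[OF insert.hyps])
qed

text \<open>\<open>k\<close> is the least index from \<open>m\<close> on whose variable divides
  \<open>u\<close>, so none of x_m, ..., x_(k-1) occurs in the cofactor. The set \<open>C\<close>
  holds variables that stay outside this sorting and remain free in every piece.\<close>

lemma split_least_variable:
  assumes u: "u \<in> monomials_in (C \<union> {m..n})" and j: "j \<in> {m..n}" "Poly_Mapping.lookup u j \<noteq> 0"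
    and C: "C \<inter> {m..n} = {}"
  obtains k w where "k \<in> {m..j}" "w \<in> monomials_in (C \<union> {k..n})" "u = Poly_Mapping.single k 1 + w"
proof -
  define k where "k = (LEAST i. m \<le> i \<and> Poly_Mapping.lookup u i \<noteq> 0)"
  have k: "m \<le> k \<and> Poly_Mapping.lookup u k \<noteq> 0"
    unfolding k_def by (rule LeastI[of _ j]) (use j in auto)
  have "k \<le> j" unfolding k_def by (rule Least_le) (use j in auto)
  obtain w where w: "u = Poly_Mapping.single k 1 + w"
    by (rule exponent_eq_single_add[OF conjunct2[OF k]])
  have "i \<in> C \<union> {k..n}" if "i \<in> Poly_Mapping.keys w" for i
  proof -
    have ui: "Poly_Mapping.lookup u i \<noteq> 0" using that by (simp add: w lookup_add in_keys_iff)
    then have "i \<in> C \<union> {m..n}" using lookup_monomials_in[OF u, of i] by fast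
    moreover have "k \<le> i" if "m \<le> i" unfolding k_def by (rule Least_le) (use that ui in auto)
    ultimately show ?thesis by auto
  qed
  then have "w \<in> monomials_in (C \<union> {k..n})" unfolding monomials_in_def by blast
  then show thesis using that[of k w] k \<open>k \<le> j\<close> w by simp
qed

text \<open>The sets of multiples for different \<open>j\<close> overlap; each multiple is
  reassigned to its least variable x_k. Since \<open>k \<le> j \<le> r\<close>, this never leaves
  the index range.\<close>

lemma multiples_eq_disjoint_translates:
  assumes "r \<le> n" "C \<inter> {m..n} = {}"
  shows "{c + Poly_Mapping.single j 1 + w | j w. j \<in> {m..r} \<and> w \<in> monomials_in (C \<union> {m..n})} =
    (\<Union>j\<in>{m..r}. (+) (c + Poly_Mapping.single j 1) ` monomials_in (C \<union> {j..n}))" (is "?L = ?R")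
proof (intro equalityI subsetI)
  fix u assume "u \<in> ?L"
  then obtain j w where jw: "u = c + Poly_Mapping.single j 1 + w" "j \<in> {m..r}"
    "w \<in> monomials_in (C \<union> {m..n})" by blast
  have "Poly_Mapping.single j 1 + w \<in> monomials_in (C \<union> {m..n})"
    using jw assms by (auto simp: monomials_in_add)
  moreover have "j \<in> {m..n}" "Poly_Mapping.lookup (Poly_Mapping.single j 1 + w) j \<noteq> 0"
    using jw assms by (auto simp: lookup_add)
  ultimately obtain k v where "k \<in> {m..j}" "v \<in> monomials_in (C \<union> {k..n})"
    "Poly_Mapping.single j 1 + w = Poly_Mapping.single k 1 + v"
    using assms(2) by (rule split_least_variable)
  then show "u \<in> ?R" using jw by (auto simp: add.assoc intro!: bexI[of _ k])
next
  fix u assume "u \<in> ?R"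
  then obtain j w where "j \<in> {m..r}" "w \<in> monomials_in (C \<union> {j..n})" "u = c + Poly_Mapping.single j 1 + w"
    by blast
  moreover have "monomials_in (C \<union> {j..n}) \<subseteq> monomials_in (C \<union> {m..n})"
    using \<open>j \<in> {m..r}\<close> by (intro monomials_in_mono) auto
  ultimately show "u \<in> ?L" by blast
qed

section \<open>Coefficients and telescoping sums of powers of 1/(1 - t)\<close>

lemma geom_inverse: "(1 - fps_X) * geom = 1"
  using geom_eq by (simp add: algebra_simps)

lemma X_mult_geom_power_Suc: "fps_X * geom ^ Suc m = geom ^ Suc m - geom ^ m"
proof -
  have "geom ^ Suc m = (1 + fps_X * geom) * geom ^ m" using geom_eq by simp
  then show ?thesis by (simp add: algebra_simps)
qed

text \<open>Comparing coefficients in \<open>step\<close> is Pascal's rule; it refers both to the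
  previous power and to the previous coefficient, hence the nested induction.\<close>

lemma geom_power_Suc_nth: "(geom ^ Suc m) $ k = int ((m + k) choose k)"
proof (induction m arbitrary: k)
  case 0
  then show ?case by simp
next
  case (Suc m)
  have step: "geom ^ Suc (Suc m) = geom ^ Suc m + fps_X * geom ^ Suc (Suc m)"
    by (subst X_mult_geom_power_Suc) simp
  show ?case
  proof (induction k)
    case 0
    then show ?case by (simp add: fps_nth_power_0)
  next
    case (Suc k)
    have "geom ^ Suc (Suc m) $ Suc k = geom ^ Suc m $ Suc k + geom ^ Suc (Suc m) $ k"
      by (subst step) simp
    then show ?case using Suc.IH \<open>\<And>k. (geom ^ Suc m) $ k = _\<close>[of "Suc k"] by simp
  qed
qed

text \<open>Truncated subtraction gives the right values at \<open>m = 0\<close> as well: 1 for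
  \<open>k = 0\<close>, and \<open>(k - 1) choose k = 0\<close> otherwise.\<close>

lemma geom_power_nth: "(geom ^ m) $ k = int ((m + k - 1) choose k)"
  by (cases m; cases k) (simp_all add: geom_power_Suc_nth del: power_Suc)

lemma one_minus_X_power_nth: "((1 - fps_X :: int fps) ^ n) $ k = (-1) ^ k * int (n choose k)"
proof (induction n arbitrary: k)
  case 0
  then show ?case by (cases k) simp_all
next
  case (Suc n)
  have "(1 - fps_X :: int fps) ^ Suc n = (1 - fps_X) ^ n - fps_X * (1 - fps_X) ^ n"
    by (simp add: algebra_simps)
  then show ?case
    by (simp only:) (cases k; simp add: Suc algebra_simps)
qed

text \<open>Telescoping: by \<open>X_mult_geom_power_Suc\<close> the summand at \<open>i\<close>
  contributes \<open>geom ^ (N + 1 - i) - geom ^ (N - i)\<close>.\<close>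

lemma sum_geom_powers:
  assumes "a \<le> r" "r \<le> N"
  shows "fps_X * (\<Sum>i\<in>{a..r}. geom ^ (N + 1 - i)) = geom ^ (N + 1 - a) - geom ^ (N - r)"
  using assms
proof (induction r rule: dec_induct)
  case base
  then show ?case using X_mult_geom_power_Suc[of "N - a"] by (simp add: Suc_diff_le)
next
  case (step r)
  have "fps_X * geom ^ (N - r) = geom ^ (N - r) - geom ^ (N - Suc r)"
    using step.prems X_mult_geom_power_Suc[of "N - Suc r"] by (simp add: Suc_diff_Suc)
  moreover have "fps_X * (\<Sum>i\<in>{a..Suc r}. geom ^ (N + 1 - i)) =
      fps_X * (\<Sum>i\<in>{a..r}. geom ^ (N + 1 - i)) + fps_X * geom ^ (N - r)"
    using step.hyps by (simp add: distrib_left)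
  ultimately show ?case using step.IH step.prems by simp
qed

section \<open>Hilbert depth under a change of the sizes of the variable sets\<close>

lemma decomposition_hdepth_eq: "decomposition_hdepth D = Min ((\<lambda>(Z, s). card Z) ` set D)"
  unfolding decomposition_hdepth_def by (rule arg_cong[of _ _ Min]) force

lemma Min_image_mono_nat:
  fixes f :: "nat \<Rightarrow> nat"
  assumes "mono f" "finite A" "A \<noteq> {}"
  shows "Min (f ` A) = f (Min A)"
  using mono_Min_commute[OF assms] by simp

text \<open>Since only sizes matter, initial segments can replace the original sets. Taking
  \<open>Suc\<close> for \<open>f\<close> multiplies the series by 1/(1 - t); taking
  \<open>\<lambda>m. m - d\<close> multiplies it by (1 - t)^d, provided that all sets have at least
  \<open>d\<close> elements.\<close>

definition resize :: "(nat \<Rightarrow> nat) \<Rightarrow> (nat set \<times> nat) list \<Rightarrow> (nat set \<times> nat) list" where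
  "resize f D = map (\<lambda>(Z, s). ({1..f (card Z)}, s)) D"

lemma decomposition_hdepth_resize:
  assumes "mono f" "D \<noteq> []"
  shows "decomposition_hdepth (resize f D) = f (decomposition_hdepth D)"
proof -
  have "(\<lambda>(Z, s). card Z) ` set (resize f D) = f ` (\<lambda>(Z, s). card Z) ` set D"
    by (force simp: resize_def)
  then show ?thesis
    using assms by (simp add: decomposition_hdepth_eq Min_image_mono_nat)
qed

lemma decomposition_series_resize:
  "decomposition_series (resize f D) = (\<Sum>(Z, s)\<leftarrow>D. fps_X ^ s * geom ^ f (card Z))"
  by (simp add: decomposition_series_def resize_def o_def case_prod_unfold)

lemma sum_list_const_mult_cong:
  fixes c :: "'a::comm_ring_1"
  assumes "\<And>x. x \<in> set xs \<Longrightarrow> f x = c * g x"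
  shows "sum_list (map f xs) = c * sum_list (map g xs)"
  using assms by (induction xs) (simp_all add: algebra_simps)

lemma decomposition_hdepth_le_card: "(Z, s) \<in> set D \<Longrightarrow> decomposition_hdepth D \<le> card Z"
  unfolding decomposition_hdepth_eq by (rule Min_le) force+

definition decomposition_hdepths :: "nat \<Rightarrow> 'k::field mpoly set \<Rightarrow> nat set" where
  "decomposition_hdepths n I = {decomposition_hdepth D | D. is_hilbert_decomposition n I D}"

lemma hdepth_eq_Max: "hdepth n I = Max (decomposition_hdepths n I)"
  by (simp add: hdepth_def decomposition_hdepths_def)

text \<open>A nonzero series rules out the empty decomposition, the one case in which
  \<open>decomposition_hdepth\<close> is a minimum over the empty set.\<close>

lemma decomposition_hdepthsE:
  assumes "d \<in> decomposition_hdepths n (supported_on B :: 'k::field mpoly set)"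
    and "B \<subseteq> monomials_in {1..n}" "monomial_series B \<noteq> 0"
  obtains D where "D \<noteq> []" "decomposition_hdepth D = d" "\<And>Z s. (Z, s) \<in> set D \<Longrightarrow> Z \<subseteq> {1..n}"
    "monomial_series B = decomposition_series D" "\<And>Z s. (Z, s) \<in> set D \<Longrightarrow> d \<le> card Z"
    "\<And>Z s. (Z, s) \<in> set D \<Longrightarrow> card Z \<le> n"
proof -
  from assms(1) obtain D where D: "decomposition_hdepth D = d"
      "is_hilbert_decomposition n (supported_on B :: 'k mpoly set) D"
    by (auto simp: decomposition_hdepths_def)
  then have sub: "Z \<subseteq> {1..n}" if "(Z, s) \<in> set D" for Z s
    using that unfolding hilbert_decomposition_iff_series[OF assms(2)] by blast
  moreover have series: "monomial_series B = decomposition_series D"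
    using D(2) by (simp add: hilbert_decomposition_iff_series[OF assms(2)])
  moreover have "D \<noteq> []"
    using series assms(3) by (auto simp: decomposition_series_def)
  moreover have "card Z \<le> n" if "(Z, s) \<in> set D" for Z s
    using card_mono[OF _ sub[OF that]] by simp
  ultimately show thesis
    using that[of D] D(1) decomposition_hdepth_le_card[of _ _ D] by blast
qed

lemma decomposition_hdepthsI:
  assumes "B \<subseteq> monomials_in {1..n}" "monomial_series B = decomposition_series D"
    and "\<And>Z s. (Z, s) \<in> set D \<Longrightarrow> Z \<subseteq> {1..n}"
  shows "decomposition_hdepth D \<in> decomposition_hdepths n (supported_on B :: 'k::field mpoly set)"
  using assms(2,3) unfolding decomposition_hdepths_def mem_Collect_eq
    hilbert_decomposition_iff_series[OF assms(1)] by blast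

text \<open>A nonzero series needs at least one summand, whose set has at most \<open>n\<close>
  elements; this bounds the depth by \<open>n\<close>.\<close>

lemma finite_decomposition_hdepths:
  assumes "B \<subseteq> monomials_in {1..n}" "monomial_series B \<noteq> 0"
  shows "finite (decomposition_hdepths n (supported_on B :: 'k::field mpoly set))"
proof (rule finite_subset)
  show "decomposition_hdepths n (supported_on B :: 'k mpoly set) \<subseteq> {..n}"
  proof
    fix d assume "d \<in> decomposition_hdepths n (supported_on B :: 'k mpoly set)"
    then obtain D where D: "D \<noteq> []" "decomposition_hdepth D = d"
      "\<And>Z s. (Z, s) \<in> set D \<Longrightarrow> card Z \<le> n"
      using assms by (rule decomposition_hdepthsE) blast
    then obtain Z s where "(Z, s) \<in> set D" by (cases D) auto
    then have "d \<le> card Z" "card Z \<le> n"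
      using decomposition_hdepth_le_card[of Z s D] D(2,3) by auto
    then show "d \<in> {..n}" by simp
  qed
qed simp

text \<open>Adding a variable to every set multiplies the series by 1/(1 - t), and removing one
  undoes this because \<open>geom\<close> can be cancelled. The bound on the sizes moves from
  \<open>n\<close> to \<open>Suc n\<close> and back, so the sets fit into the respective
  rings.\<close>

lemma hdepth_Suc:
  assumes B: "B \<subseteq> monomials_in {1..n}" and B': "B' \<subseteq> monomials_in {1..Suc n}"
    and nz: "monomial_series B \<noteq> 0" and series: "monomial_series B' = geom * monomial_series B"
    and ne: "decomposition_hdepths n (supported_on B :: 'k::field mpoly set) \<noteq> {}"
  shows "hdepth (Suc n) (supported_on B' :: 'k mpoly set) = hdepth n (supported_on B :: 'k mpoly set) + 1"
proof -
  let ?S = "decomposition_hdepths n (supported_on B :: 'k mpoly set)"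
  let ?S' = "decomposition_hdepths (Suc n) (supported_on B' :: 'k mpoly set)"
  have "geom \<noteq> 0" using geom_inverse by force
  then have nz': "monomial_series B' \<noteq> 0" using nz series by simp
  have up: "Suc d \<in> ?S'" if d: "d \<in> ?S" for d
  proof -
    obtain D where D: "D \<noteq> []" "decomposition_hdepth D = d" "monomial_series B = decomposition_series D"
        "\<And>Z s. (Z, s) \<in> set D \<Longrightarrow> card Z \<le> n"
      using d B nz by (rule decomposition_hdepthsE) blast
    have "decomposition_series (resize Suc D) = geom * decomposition_series D"
      unfolding decomposition_series_resize decomposition_series_def[of D]
      by (rule sum_list_const_mult_cong) auto
    moreover have "Z \<subseteq> {1..Suc n}" if "(Z, s) \<in> set (resize Suc D)" for Z s
      using that D(4) by (fastforce simp: resize_def)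
    ultimately have "decomposition_hdepth (resize Suc D) \<in> ?S'"
      using D(3) series by (intro decomposition_hdepthsI[OF B']) auto
    then show ?thesis
      using D by (simp add: decomposition_hdepth_resize mono_Suc)
  qed
  have down: "d - 1 \<in> ?S" if d: "d \<in> ?S'" "1 \<le> d" for d
  proof -
    obtain D where D: "D \<noteq> []" "decomposition_hdepth D = d" "monomial_series B' = decomposition_series D"
        "\<And>Z s. (Z, s) \<in> set D \<Longrightarrow> card Z \<le> Suc n" "\<And>Z s. (Z, s) \<in> set D \<Longrightarrow> d \<le> card Z"
      using d(1) B' nz' by (rule decomposition_hdepthsE) blast
    let ?f = "\<lambda>m. m - 1 :: nat"
    have "decomposition_series D = geom * decomposition_series (resize ?f D)"
      unfolding decomposition_series_resize decomposition_series_def[of D]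
    proof (rule sum_list_const_mult_cong, clarify)
      fix Z s assume "(Z, s) \<in> set D"
      \<comment> \<open>Depth at least 1 makes every \<open>Z\<close> nonempty, so the truncated
        subtraction is exact and a factor \<open>geom\<close> splits off.\<close>
      then have "card Z = Suc (card Z - 1)" using D(5) d(2) by fastforce
      then have "geom ^ card Z = geom * geom ^ (card Z - 1)" by (metis power_Suc)
      then show "fps_X ^ s * geom ^ card Z = geom * (fps_X ^ s * geom ^ (card Z - 1))" by simp
    qed
    then have "monomial_series B = decomposition_series (resize ?f D)"
      using D(3) series \<open>geom \<noteq> 0\<close> by simp
    moreover have "Z \<subseteq> {1..n}" if "(Z, s) \<in> set (resize ?f D)" for Z s
      using that D(4) by (fastforce simp: resize_def)
    ultimately have "decomposition_hdepth (resize ?f D) \<in> ?S"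
      by (intro decomposition_hdepthsI[OF B])
    moreover have "mono ?f" by (auto simp: mono_def)
    ultimately show ?thesis
      using D(1,2) by (simp add: decomposition_hdepth_resize)
  qed
  note fin = finite_decomposition_hdepths[OF B nz, where 'k = 'k]
    and fin' = finite_decomposition_hdepths[OF B' nz', where 'k = 'k]
  have "Suc (Max ?S) \<in> ?S'" using up Max_in[OF fin ne] by blast
  then have *: "Suc (Max ?S) \<le> Max ?S'" and "?S' \<noteq> {}" using fin' by auto
  \<comment> \<open>\<open>down\<close> requires positive depth. The maximum has it, being at least
    \<open>Suc (Max ?S)\<close>, so decompositions of depth 0 do no harm.\<close>
  then have "Max ?S' - 1 \<in> ?S" using down Max_in[OF fin'] by fastforce
  then have "Max ?S' - 1 \<le> Max ?S" using fin by simp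
  then show ?thesis using * by (simp add: hdepth_eq_Max)
qed

text \<open>Multiplication by (1 - t)^d leaves t^s / (1 - t)^(|Z| - d) of each summand, whose
  coefficients are binomial coefficients or 0.\<close>

lemma decomposition_hdepth_obstruction:
  assumes "\<And>Z s. (Z, s) \<in> set D \<Longrightarrow> d \<le> card Z"
  shows "0 \<le> ((1 - fps_X) ^ d * decomposition_series D) $ k"
proof -
  have "decomposition_series D = geom ^ d * decomposition_series (resize (\<lambda>m. m - d) D)"
    unfolding decomposition_series_resize decomposition_series_def[of D]
  proof (rule sum_list_const_mult_cong, clarify)
    fix Z s assume "(Z, s) \<in> set D"
    then have "geom ^ card Z = geom ^ d * geom ^ (card Z - d)"
      using assms by (simp flip: power_add)
    then show "fps_X ^ s * geom ^ card Z = geom ^ d * (fps_X ^ s * geom ^ (card Z - d))"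
      by simp
  qed
  then have "(1 - fps_X) ^ d * decomposition_series D =
      ((1 - fps_X) * geom) ^ d * decomposition_series (resize (\<lambda>m. m - d) D)"
    by (simp only: power_mult_distrib mult.assoc)
  also have "\<dots> = decomposition_series (resize (\<lambda>m. m - d) D)" by (simp add: geom_inverse)
  finally have eq: "(1 - fps_X) ^ d * decomposition_series D = decomposition_series (resize (\<lambda>m. m - d) D)" .
  have "0 \<le> decomposition_series D' $ k" for D'
    unfolding decomposition_series_def
    by (induction D') (auto simp: fps_X_power_mult_nth geom_power_nth)
  then show ?thesis by (simp only: eq)
qed

lemma fps_two_terms:
  fixes f :: "int fps"
  assumes "f $ 0 = 0" "f $ 1 = 0"
  shows "\<exists>F. f = fps_const (f $ 2) * fps_X ^ 2 + fps_const (f $ 3) * fps_X ^ 3 + fps_X ^ 4 * F"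
proof (rule exI[of _ "fps_shift 4 f"], rule fps_ext)
  fix k :: nat
  consider "k = 0" | "k = 1" | "k = 2" | "k = 3" | "k \<ge> 4" by linarith
  then show "f $ k = (fps_const (f $ 2) * fps_X ^ 2 + fps_const (f $ 3) * fps_X ^ 3
      + fps_X ^ 4 * fps_shift 4 f) $ k"
    using assms by cases (simp_all add: fps_X_power_mult_nth)
qed

section \<open>Generators, monomials and the lex property of both ideals\<close>

text \<open>Both ideals are handled at once: \<open>q = 0\<close> gives \<open>L\<close> and \<open>q = 1\<close>, which shifts the second
  index of each generator, gives \<open>L\<^sup>\<sigma>\<close> (for \<open>N = 100\<close> and \<open>r = 13\<close>).\<close>

definition edge :: "nat \<Rightarrow> nat \<Rightarrow> (nat \<Rightarrow>\<^sub>0 nat)" where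
  "edge a j = Poly_Mapping.single a 1 + Poly_Mapping.single j 1"

definition lex_gens :: "nat \<Rightarrow> nat \<Rightarrow> nat \<Rightarrow> (nat \<Rightarrow>\<^sub>0 nat) set" where
  "lex_gens N r q = edge 1 ` {1 + q..N + q} \<union> edge 2 ` {2 + q..r + q}"

definition lex_monomials :: "nat \<Rightarrow> nat \<Rightarrow> nat \<Rightarrow> (nat \<Rightarrow>\<^sub>0 nat) set" where
  "lex_monomials N r q = monomial_multiples (N + q) (lex_gens N r q)"

lemma mdeg_edge [simp]: "mdeg (edge a j) = 2"
  by (simp add: edge_def)

lemma lookup_edge:
  "Poly_Mapping.lookup (edge a j) i = (if i = a then 1 else 0) + (if i = j then 1 else 0)"
  by (auto simp: edge_def lookup_add lookup_single when_def)

lemma Var_mult_Var: "Var a * Var j = monomial (edge a j)"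
  by (simp add: Var_def monomial_def edge_def mult_single)

lemma edge_monomials_in [simp]: "edge a j \<in> monomials_in Z \<longleftrightarrow> a \<in> Z \<and> j \<in> Z"
  by (simp add: edge_def monomials_in_add)

lemma lex_gens_subset:
  assumes "2 \<le> r" "r \<le> N"
  shows "lex_gens N r q \<subseteq> monomials_in {1..N + q}"
  using assms by (auto simp: lex_gens_def)

lemma lex_gens_squarefree:
  assumes "2 \<le> r" "r \<le> N"
  shows "lex_gens N r 1 \<subseteq> squarefree_monomials_in {1..N + 1}"
  using lex_gens_subset[OF assms, of 1]
  by (auto simp: squarefree_monomials_in_def lex_gens_def lookup_edge)

lemma mdeg_lex_monomials: "u \<in> lex_monomials N r q \<Longrightarrow> 2 \<le> mdeg u"
  by (auto simp: lex_monomials_def monomial_multiples_def lex_gens_def)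

text \<open>Some generator divides \<open>u\<close>. For \<open>a = 1\<close> nothing is recorded
  about \<open>j\<close>, since that case only serves to conclude that x_1 divides
  \<open>u\<close>.\<close>

lemma lex_monomials_cases:
  assumes "u \<in> lex_monomials N r q"
  obtains a j where "a = 1 \<or> a = 2 \<and> j \<in> {2 + q..r + q}"
    "\<And>i. Poly_Mapping.lookup (edge a j) i \<le> Poly_Mapping.lookup u i"
proof -
  obtain g w where g: "g \<in> lex_gens N r q" "u = g + w"
    using assms unfolding lex_monomials_def monomial_multiples_def by blast
  from g(1) consider j where "g = edge 1 j" | j where "g = edge 2 j" "j \<in> {2 + q..r + q}"
    unfolding lex_gens_def by blast
  then show thesis
  proof cases
    case (1 j)
    then show thesis using that[of 1 j] g(2) by (simp add: lookup_add)
  next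
    case (2 j)
    then show thesis using that[of 2 j] g(2) by (simp add: lookup_add)
  qed
qed

text \<open>A second variable x_j of \<open>v\<close> gives a divisor x_1 x_j, and all these
  products are generators up to the range of \<open>j\<close>. For \<open>q = 1\<close> the square
  of x_1 is not among them, so exponent 1 is required to force \<open>j \<noteq> 1\<close>.\<close>

lemma lex_monomials_first_variable:
  assumes v: "v \<in> monomials_in {1..N + q}" and v1: "Poly_Mapping.lookup v 1 \<noteq> 0" and deg: "2 \<le> mdeg v"
    and q: "q = 0 \<or> q = 1 \<and> Poly_Mapping.lookup v 1 = 1"
  shows "v \<in> lex_monomials N r q"
proof -
  obtain w where w: "v = Poly_Mapping.single 1 1 + w"
    by (rule exponent_eq_single_add[OF v1])
  then have "mdeg w \<noteq> 0" using deg by simp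
  then obtain j where j: "Poly_Mapping.lookup w j \<noteq> 0"
    unfolding mdeg_def by (meson sum.neutral)
  have "w \<in> monomials_in {1..N + q}" using v unfolding w monomials_in_add by blast
  from lookup_monomials_in[OF this, of j] j have "j \<in> {1..N + q}" by argo
  moreover have "j \<noteq> 1" if "q = 1"
    using q j that by (auto simp: w lookup_add)
  ultimately have "j \<in> {1 + q..N + q}" using q by auto
  then show ?thesis
    unfolding lex_monomials_def using v j
    by (intro monomial_multiplesI[of "edge 1 j"])
      (auto simp: lex_gens_def w lookup_edge lookup_add lookup_single when_def)
qed

text \<open>If x_1 divides \<open>v\<close>, the degree suffices. Otherwise the first difference
  \<open>i\<close> exceeds 1, so x_1 does not divide \<open>u\<close> either, and some generator x_2
  x_j divides \<open>u\<close>. Then x_2 x_k divides \<open>v\<close> for the smaller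
  \<open>k\<close> of \<open>i\<close> and \<open>j\<close>: before \<open>i\<close> the exponents
  agree, and at \<open>i\<close> that of \<open>v\<close> is positive.\<close>

lemma lex_monomials_lex_closed:
  assumes u: "u \<in> lex_monomials N r q" and "2 \<le> r" "r \<le> N"
    and v: "v \<in> monomials_in {1..N + q}" and deg: "mdeg v = mdeg u" and less: "u < v"
    and q: "q = 0 \<or> q = 1 \<and> (\<forall>i. Poly_Mapping.lookup v i \<le> 1)"
  shows "v \<in> lex_monomials N r q"
proof (cases "Poly_Mapping.lookup v 1 = 0")
  case False
  moreover have "2 \<le> mdeg v" using deg mdeg_lex_monomials[OF u] by simp
  moreover have "q = 0 \<or> q = 1 \<and> Poly_Mapping.lookup v 1 = 1"
    using q False by (metis One_nat_def le_Suc_eq le_zero_eq)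
  ultimately show ?thesis using v by (intro lex_monomials_first_variable)
next
  case v1: True
  obtain i where i: "Poly_Mapping.lookup u i < Poly_Mapping.lookup v i"
      and eq: "\<And>j. j < i \<Longrightarrow> Poly_Mapping.lookup v j = Poly_Mapping.lookup u j"
    using less lex_less_iff by blast
  have "i \<in> {1..N + q}" using i lookup_monomials_in[OF v] by (metis not_less_zero)
  moreover have "i \<noteq> 1" using i v1 by auto
  ultimately have i2: "2 \<le> i" "i \<le> N + q" by auto
  then have u1: "Poly_Mapping.lookup u 1 = 0" using eq[of 1] v1 by simp
  obtain a j where aj: "a = 1 \<or> a = 2 \<and> j \<in> {2 + q..r + q}"
      and le: "\<And>i. Poly_Mapping.lookup (edge a j) i \<le> Poly_Mapping.lookup u i"
    using u by (rule lex_monomials_cases) blast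
  have "a \<noteq> 1" using le[of 1] u1 by (auto simp: lookup_edge)
  then have a: "a = 2" and j: "j \<in> {2 + q..r + q}" using aj by auto
  have u2: "1 \<le> Poly_Mapping.lookup u 2" using le[of 2] by (simp add: a lookup_edge)
  define k where "k = (if i < j then i else j)"
  have "k \<in> {2 + q..r + q} \<and> (\<forall>l. Poly_Mapping.lookup (edge 2 k) l \<le> Poly_Mapping.lookup v l)"
  proof (cases "i = 2")
    case True
    then have "2 \<le> Poly_Mapping.lookup v 2" using i u2 by simp
    \<comment> \<open>For \<open>q = 1\<close> the exponents of \<open>v\<close> are at most 1. So
      here \<open>q = 0\<close>, and the square of x_2 is the generator used, with
      \<open>k = 2\<close>.\<close>
    moreover from this have "q = 0" using q by (metis Suc_1 not_less_eq_eq One_nat_def)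
    ultimately show ?thesis using True j by (auto simp: k_def lookup_edge)
  next
    case False
    then have v2: "Poly_Mapping.lookup v 2 = Poly_Mapping.lookup u 2" using eq[of 2] i2 by simp
    show ?thesis
    proof (cases "i \<le> j")
      case True
      then have "k = i" by (simp add: k_def)
      moreover have "1 \<le> Poly_Mapping.lookup v i" using i by simp
      moreover have "i \<in> {2 + q..r + q}" using i2 False True j q by auto
      ultimately show ?thesis using False u2 v2 by (auto simp: lookup_edge)
    next
      case False
      then have k: "k = j" by (simp add: k_def)
      have "Poly_Mapping.lookup (edge 2 j) l \<le> Poly_Mapping.lookup v l" for l
      proof (cases "l = 2 \<or> l = j")
        case True
        then have "Poly_Mapping.lookup v l = Poly_Mapping.lookup u l"
          using v2 eq[of j] False by auto
        then show ?thesis using le[of l] by (simp add: a)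
      qed (simp add: lookup_edge)
      then show ?thesis using k j by simp
    qed
  qed
  then show ?thesis
    unfolding lex_monomials_def lex_gens_def
    by (intro monomial_multiplesI[of "edge 2 k"] v) auto
qed

text \<open>A multiple of x_2 x_j divisible by x_1 is already a multiple of x_1 x_2 and belongs to
  the first block; the others have cofactors without x_1. For \<open>q = 1\<close> the second index
  starts above the leading variable, which may still occur in the cofactor: this accounts for
  \<open>{1..q}\<close> and \<open>{2..1 + q}\<close>, both empty for \<open>q = 0\<close>.\<close>

lemma lex_monomials_eq:
  assumes "2 \<le> r" "r \<le> N" "q \<le> 1"
  shows "lex_monomials N r q =
      (\<Union>j\<in>{1 + q..N + q}. (+) (Poly_Mapping.single 1 1 + Poly_Mapping.single j 1) `
         monomials_in ({1..q} \<union> {j..N + q})) \<union>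
      (\<Union>j\<in>{2 + q..r + q}. (+) (Poly_Mapping.single 2 1 + Poly_Mapping.single j 1) `
         monomials_in ({2..1 + q} \<union> {j..N + q}))" (is "_ = ?B1 \<union> ?B2")
proof -
  let ?M = "\<lambda>a J. monomial_multiples (N + q) (edge a ` J)"
  have B1: "?B1 = {Poly_Mapping.single 1 1 + Poly_Mapping.single j 1 + w | j w.
      j \<in> {1 + q..N + q} \<and> w \<in> monomials_in ({1..q} \<union> {1 + q..N + q})}"
    by (rule multiples_eq_disjoint_translates[symmetric]) auto
  have B2: "?B2 = {Poly_Mapping.single 2 1 + Poly_Mapping.single j 1 + w | j w.
      j \<in> {2 + q..r + q} \<and> w \<in> monomials_in ({2..1 + q} \<union> {2 + q..N + q})}"
    by (rule multiples_eq_disjoint_translates[symmetric]) (use assms in auto)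
  have Z1: "{1..q} \<union> {1 + q..N + q} = {1..N + q}" by auto
  have Z2: "{2..1 + q} \<union> {2 + q..N + q} = {2..N + q}" using assms by auto
  have M1: "?B1 = ?M 1 {1 + q..N + q}"
    unfolding B1 Z1 monomial_multiples_def edge_def by blast
  have M2: "?B2 \<subseteq> ?M 2 {2 + q..r + q}"
    unfolding B2 Z2 monomial_multiples_def edge_def
    using monomials_in_mono[of "{2..N + q}" "{1..N + q}"] by force
  have M12: "?M 2 {2 + q..r + q} \<subseteq> ?M 1 {1 + q..N + q} \<union> ?B2"
  proof
    fix u assume "u \<in> ?M 2 {2 + q..r + q}"
    then obtain j w where u: "u = edge 2 j + w" "j \<in> {2 + q..r + q}" "w \<in> monomials_in {1..N + q}"
      unfolding monomial_multiples_def by blast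
    show "u \<in> ?M 1 {1 + q..N + q} \<union> ?B2"
    proof (cases "Poly_Mapping.lookup w 1 = 0")
      case True
      have "w \<in> monomials_in {2..N + q}"
        unfolding monomials_in_def
      proof (clarify)
        fix i assume "i \<in> Poly_Mapping.keys w"
        then have "i \<in> {1..N + q}" "i \<noteq> 1"
          using u(3) True unfolding monomials_in_def in_keys_iff[symmetric] by (blast, metis in_keys_iff)
        then show "i \<in> {2..N + q}" by auto
      qed
      then have "u \<in> ?B2" unfolding B2 Z2 using u by (auto simp: edge_def)
      then show ?thesis ..
    next
      case False
      then have "u \<in> ?M 1 {1 + q..N + q}"
        using u assms
        by (intro monomial_multiplesI[of "edge 1 2"])
          (auto simp: lookup_edge lookup_add monomials_in_add)
      then show ?thesis ..
    qed
  qed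
  have "lex_monomials N r q = ?M 1 {1 + q..N + q} \<union> ?M 2 {2 + q..r + q}"
    by (simp add: lex_monomials_def lex_gens_def monomial_multiples_Un)
  also have "\<dots> = ?M 1 {1 + q..N + q} \<union> ?B2"
    by (intro equalityI Un_least Un_upper1 M12 order_trans[OF M2 Un_upper2])
  finally show ?thesis unfolding M1 .
qed

section \<open>The Hilbert series of the two ideals\<close>

definition lex_series :: "nat \<Rightarrow> nat \<Rightarrow> int fps" where
  "lex_series N r = fps_X ^ 2 *
     ((\<Sum>i\<in>{1..N}. geom ^ (N + 1 - i)) + (\<Sum>i\<in>{2..r}. geom ^ (N + 1 - i)))"

text \<open>Put \<open>j = i + q\<close>. The variables from x_j to the last one number
  \<open>N + 1 - i\<close> for either \<open>q\<close>, because the shift of the index cancels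
  against that of the ring. For \<open>q = 1\<close> the leading variable in \<open>C\<close> comes
  on top, which gives the factor \<open>geom ^ q\<close> in every piece.\<close>

lemma monomial_series_lex_monomials:
  assumes "2 \<le> r" "r \<le> N" "q \<le> 1"
  shows "monomial_series (lex_monomials N r q) = geom ^ q * lex_series N r"
proof -
  let ?B = "\<lambda>a C J. \<Union>j\<in>J. (+) (Poly_Mapping.single a 1 + Poly_Mapping.single j (1::nat)) `
      monomials_in (C \<union> {j..N + q})"
  let ?B1 = "?B 1 {1..q} {1 + q..N + q}" and ?B2 = "?B 2 {2..1 + q} {2 + q..r + q}"
  have series: "monomial_series (?B a C {m + q..p + q}) =
      geom ^ q * (fps_X ^ 2 * (\<Sum>i\<in>{m..p}. geom ^ (N + 1 - i)))"
    if "p \<le> N" "1 \<le> m" "a \<in> {1..2}" "C \<subseteq> {1..N + q}" "card C = q" "C \<inter> {m + q..} = {}" for a C m p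
  proof -
    have card: "card (C \<union> {j..N + q}) = q + (N + q + 1 - j)" if "j \<in> {m + q..p + q}" for j
    proof -
      have "C \<inter> {j..N + q} = {}" using \<open>C \<inter> {m + q..} = {}\<close> that by auto
      then show ?thesis
        using \<open>C \<subseteq> _\<close> \<open>card C = q\<close> finite_subset[of C "{1..N + q}"] by (simp add: card_Un_disjoint)
    qed
    have "monomial_series (?B a C {m + q..p + q}) =
        (\<Sum>j\<in>{m + q..p + q}. fps_X ^ (mdeg (Poly_Mapping.single a 1) + 1) * geom ^ card (C \<union> {j..N + q}))"
      using that assms
      by (intro monomial_series_disjoint_translates[of _ "{1..N + q}"]) (auto simp: monomials_in_add)
    also have "\<dots> = (\<Sum>j\<in>{m + q..p + q}. fps_X ^ 2 * geom ^ (q + (N + q + 1 - j)))"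
      by (intro sum.cong refl) (simp add: card power2_eq_square)
    also have "\<dots> = (\<Sum>i\<in>{m..p}. fps_X ^ 2 * geom ^ (q + (N + 1 - i)))"
      by (subst sum.shift_bounds_cl_nat_ivl) simp
    also have "\<dots> = geom ^ q * (fps_X ^ 2 * (\<Sum>i\<in>{m..p}. geom ^ (N + 1 - i)))"
      by (simp add: power_add sum_distrib_left algebra_simps)
    finally show ?thesis .
  qed
  have B1: "monomial_series ?B1 = geom ^ q * (fps_X ^ 2 * (\<Sum>i\<in>{1..N}. geom ^ (N + 1 - i)))"
    using assms by (intro series) auto
  have B2: "monomial_series ?B2 = geom ^ q * (fps_X ^ 2 * (\<Sum>i\<in>{2..r}. geom ^ (N + 1 - i)))"
    using assms by (intro series) auto
  have "lex_monomials N r q \<subseteq> monomials_in {1..N + q}"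
    unfolding lex_monomials_def using lex_gens_subset[OF assms(1,2)] by (rule monomial_multiples_subset)
  then have sub: "?B1 \<subseteq> monomials_in {1..N + q}" "?B2 \<subseteq> monomials_in {1..N + q}"
    using lex_monomials_eq[OF assms] by blast+
  \<comment> \<open>The exponent of x_1 separates the two blocks.\<close>
  have "Poly_Mapping.lookup u 1 \<noteq> 0" if "u \<in> ?B1" for u
    using that by (auto simp: lookup_add)
  moreover have "Poly_Mapping.lookup u 1 = 0" if "u \<in> ?B2" for u
  proof -
    from that obtain j w where "j \<in> {2 + q..r + q}" "w \<in> monomials_in ({2..1 + q} \<union> {j..N + q})"
      "u = Poly_Mapping.single 2 1 + Poly_Mapping.single j 1 + w" by blast
    moreover from this have "Poly_Mapping.lookup w 1 = 0" by (intro lookup_monomials_in) auto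
    ultimately show ?thesis by (simp add: lookup_add lookup_single)
  qed
  ultimately have disj: "?B1 \<inter> ?B2 = {}" by blast
  have "monomial_series (lex_monomials N r q) = monomial_series ?B1 + monomial_series ?B2"
    unfolding lex_monomials_eq[OF assms] by (rule monomial_series_Un[OF sub _ disj]) simp
  then show ?thesis unfolding B1 B2 lex_series_def by (simp add: algebra_simps)
qed

lemma lex_series_closed_form:
  assumes "2 \<le> r" "r \<le> N"
  shows "lex_series N r = fps_X * (geom ^ N - 1 + geom ^ (N - 1) - geom ^ (N - r))"
proof -
  have "fps_X * (\<Sum>i\<in>{1..N}. geom ^ (N + 1 - i)) = geom ^ N - 1"
    using sum_geom_powers[of 1 N N] assms by simp
  moreover have "fps_X * (\<Sum>i\<in>{2..r}. geom ^ (N + 1 - i)) = geom ^ (N - 1) - geom ^ (N - r)"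
    using sum_geom_powers[of 2 r N] assms by simp
  moreover have "lex_series N r = fps_X * (fps_X * (\<Sum>i\<in>{1..N}. geom ^ (N + 1 - i)) +
      fps_X * (\<Sum>i\<in>{2..r}. geom ^ (N + 1 - i)))"
    by (simp add: lex_series_def power2_eq_square algebra_simps)
  ultimately show ?thesis by (simp only: add_diff_eq)
qed

text \<open>Ensures that the \<open>Max\<close> in \<open>hdepth\<close> is over a nonempty set.
  \<open>{1..N + 1 - i}\<close> stands in for \<open>{i..N}\<close>, which has the same
  size.\<close>

lemma lex_series_decomposition:
  assumes "2 \<le> r" "r \<le> N"
  shows "\<exists>D. decomposition_series D = lex_series N r \<and> (\<forall>(Z, s)\<in>set D. Z \<subseteq> {1..N})"
proof (intro exI conjI)
  let ?D = "map (\<lambda>i. ({1..N + 1 - i}, 2)) ([1..<Suc N] @ [2..<Suc r])"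
  show "decomposition_series ?D = lex_series N r"
    unfolding decomposition_series_def lex_series_def
    by (simp add: o_def sum_distrib_left distrib_left interv_sum_list_conv_sum_set_nat
        atLeastLessThanSuc_atLeastAtMost del: upt_Suc)
  show "\<forall>(Z, s)\<in>set ?D. Z \<subseteq> {1..N}" by auto
qed

lemma ideal_gen_lex_gens:
  assumes "2 \<le> r" "r \<le> N" "n = N + q"
  shows "ideal_gen n (monomial ` lex_gens N r q :: 'k::field mpoly set) = supported_on (lex_monomials N r q)"
  unfolding lex_monomials_def assms(3) by (rule ideal_gen_monomials[OF lex_gens_subset[OF assms(1,2)]])

lemma lex_monomials_subset:
  assumes "2 \<le> r" "r \<le> N"
  shows "lex_monomials N r q \<subseteq> monomials_in {1..N + q}"
  unfolding lex_monomials_def using lex_gens_subset[OF assms] by (rule monomial_multiples_subset)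

lemma is_lex_ideal_lex_monomials:
  assumes "2 \<le> r" "r \<le> N"
  shows "is_lex_ideal N (supported_on (lex_monomials N r 0) :: 'k::field mpoly set)"
  unfolding is_lex_ideal_def is_monomial_ideal_def
proof (intro conjI ballI impI)
  show "\<exists>M\<subseteq>monomials_in {1..N}.
      (supported_on (lex_monomials N r 0) :: 'k mpoly set) = ideal_gen N (monomial ` M)"
    using lex_gens_subset[OF assms, of 0] ideal_gen_lex_gens[where 'k = 'k, OF assms, of N 0]
    by (intro exI[of _ "lex_gens N r 0"]) simp
next
  fix u v
  assume "v \<in> monomials_in {1..N}"
    and "(monomial u :: 'k mpoly) \<in> supported_on (lex_monomials N r 0) \<and> mdeg v = mdeg u \<and> u < v"
  then show "(monomial v :: 'k mpoly) \<in> supported_on (lex_monomials N r 0)"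
    using lex_monomials_lex_closed[of u N r 0 v] assms by simp
qed

lemma is_squarefree_lex_ideal_lex_monomials:
  assumes "2 \<le> r" "r \<le> N"
  shows "is_squarefree_lex_ideal (N + 1) (supported_on (lex_monomials N r 1) :: 'k::field mpoly set)"
  unfolding is_squarefree_lex_ideal_def is_squarefree_monomial_ideal_def
proof (intro conjI ballI impI)
  show "\<exists>M\<subseteq>squarefree_monomials_in {1..N + 1}.
      (supported_on (lex_monomials N r 1) :: 'k mpoly set) = ideal_gen (N + 1) (monomial ` M)"
    using lex_gens_squarefree[OF assms] ideal_gen_lex_gens[where 'k = 'k, OF assms, of "N + 1" 1]
    by (intro exI[of _ "lex_gens N r 1"]) simp
next
  fix u v
  assume "u \<in> squarefree_monomials_in {1..N + 1}" "v \<in> squarefree_monomials_in {1..N + 1}"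
    and "(monomial u :: 'k mpoly) \<in> supported_on (lex_monomials N r 1) \<and> mdeg v = mdeg u \<and> u < v"
  then show "(monomial v :: 'k mpoly) \<in> supported_on (lex_monomials N r 1)"
    using lex_monomials_lex_closed[of u N r 1 v] assms by (simp add: squarefree_monomials_in_def)
qed

section \<open>The numerical coefficients\<close>

lemma lex_series_100_13:
  "geom ^ q * lex_series 100 13 =
     fps_X * (geom ^ (100 + q) - geom ^ q + geom ^ (99 + q) - geom ^ (87 + q))"
proof -
  have "lex_series 100 13 = fps_X * (geom ^ 100 - 1 + geom ^ 99 - geom ^ 87)"
    using lex_series_closed_form[of 13 100] by simp
  then show ?thesis by (simp only: power_add) (simp only: algebra_simps mult_1)
qed

text \<open>112 = 100 + 12 is the number of generators. In degree 3 the closed form gives 5050 +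
  4950 - 3828 = 6172, and the extra factor 1/(1 - t) adds 112 to this.\<close>

lemma lex_series_100_13_two_terms:
  "\<exists>F. lex_series 100 13 = 112 * fps_X ^ 2 + 6172 * fps_X ^ 3 + fps_X ^ 4 * F"
  "\<exists>F. geom * lex_series 100 13 = 112 * fps_X ^ 2 + 6284 * fps_X ^ 3 + fps_X ^ 4 * F"
proof -
  have nth: "(fps_X * f) $ 2 = f $ 1" "(fps_X * f) $ 3 = f $ 2" for f :: "int fps"
    by (simp_all add: numeral_2_eq_2 numeral_3_eq_3)
  \<comment> \<open>Writing 1 and \<open>geom\<close> as powers lets \<open>geom_power_nth\<close>
    treat all four summands alike; for the same reason \<open>power_0\<close> and
    \<open>power_one_right\<close> are removed from the simpset below.\<close>
  have 0: "lex_series 100 13 = fps_X * (geom ^ 100 - geom ^ 0 + geom ^ 99 - geom ^ 87)"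
    using lex_series_100_13[of 0] by simp
  have 1: "geom * lex_series 100 13 = fps_X * (geom ^ 101 - geom ^ 1 + geom ^ 100 - geom ^ 88)"
    using lex_series_100_13[of 1] by simp
  have f0: "lex_series 100 13 $ 0 = 0" "lex_series 100 13 $ 1 = 0" "lex_series 100 13 $ 2 = 112"
      "lex_series 100 13 $ 3 = 6172"
    unfolding 0 by (simp_all only: nth fps_sub_nth fps_add_nth geom_power_nth)
      (simp_all add: geom_power_nth choose_two del: power_0)
  have f1: "(geom * lex_series 100 13) $ 0 = 0" "(geom * lex_series 100 13) $ 1 = 0"
      "(geom * lex_series 100 13) $ 2 = 112" "(geom * lex_series 100 13) $ 3 = 6284"
    unfolding 1 by (simp_all only: nth fps_sub_nth fps_add_nth geom_power_nth)
      (simp_all add: geom_power_nth choose_two del: power_one_right)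
  show "\<exists>F. lex_series 100 13 = 112 * fps_X ^ 2 + 6172 * fps_X ^ 3 + fps_X ^ 4 * F"
    using fps_two_terms[OF f0(1,2)] unfolding f0 by (simp only: numeral_fps_const)
  show "\<exists>F. geom * lex_series 100 13 = 112 * fps_X ^ 2 + 6284 * fps_X ^ 3 + fps_X ^ 4 * F"
    using fps_two_terms[OF f1(1,2)] unfolding f1 by (simp only: numeral_fps_const)
qed

text \<open>The exponents 100, 99 and 87 are split off 55 as 45, 44 and 32. The factor
  \<open>fps_X\<close> moves the coefficient sought to degree 4, where the sum is 194580 - 341055 +
  178365 - 52360.\<close>

lemma lex_series_100_13_negative_coeff:
  "((1 - fps_X) ^ 55 * lex_series 100 13) $ 5 = - 20470"
proof -
  have cancel: "(1 - fps_X) ^ 55 * geom ^ (55 + m) = geom ^ m" for m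
    by (simp add: power_add geom_inverse flip: mult.assoc power_mult_distrib)
  have "lex_series 100 13 = fps_X * (geom ^ (55 + 45) - 1 + geom ^ (55 + 44) - geom ^ (55 + 32))"
    using lex_series_100_13[of 0] by simp
  then have "(1 - fps_X) ^ 55 * lex_series 100 13 = (1 - fps_X) ^ 55 *
      (fps_X * (geom ^ (55 + 45) - 1 + geom ^ (55 + 44) - geom ^ (55 + 32)))"
    by (simp only:)
  also have "\<dots> = fps_X * ((1 - fps_X) ^ 55 * geom ^ (55 + 45)
      - (1 - fps_X) ^ 55 + (1 - fps_X) ^ 55 * geom ^ (55 + 44) - (1 - fps_X) ^ 55 * geom ^ (55 + 32))"
    by (simp only: algebra_simps mult_1 mult_1_right)
  also have "\<dots> = fps_X * (geom ^ 45 - (1 - fps_X) ^ 55 + geom ^ 44 - geom ^ 32)"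
    by (simp only: cancel)
  also have "\<dots> $ 5 = int (48 choose 4) - int (55 choose 4) + int (47 choose 4) - int (35 choose 4)"
    by (simp add: geom_power_nth one_minus_X_power_nth)
  also have "\<dots> = - 20470"
    by (simp add: binomial_fact' fact_numeral)
  finally show ?thesis .
qed

theorem mainTheorem7:
  fixes L L\<sigma> :: "'k::field mpoly set"
  assumes L: "L = ideal_gen 100 ({Var 1 * Var j | j. j \<in> {1..100}} \<union> {Var 2 * Var j | j. j \<in> {2..13}})"
    and L\<sigma>: "L\<sigma> = ideal_gen 101 ({Var 1 * Var j | j. j \<in> {2..101}} \<union> {Var 2 * Var j | j. j \<in> {3..14}})"
  shows
    "is_lex_ideal 100 L \<and>
     (\<exists>M \<subseteq> {u \<in> monomials_in {1..100}. mdeg u = 2}. L = ideal_gen 100 (monomial ` M)) \<and>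
     (\<exists>F. hilbert_series L = 112 * fps_X ^ 2 + 6172 * fps_X ^ 3 + fps_X ^ 4 * F) \<and>
     hdepth 100 L \<le> 54 \<and>
     int (hdepth 100 L) \<noteq> \<lfloor>6172 / 112 :: real\<rfloor> \<and> \<lfloor>6172 / 112 :: real\<rfloor> = 55 \<and>
     is_squarefree_lex_ideal 101 L\<sigma> \<and>
     (\<exists>M \<subseteq> {u \<in> squarefree_monomials_in {1..101}. mdeg u = 2}. L\<sigma> = ideal_gen 101 (monomial ` M)) \<and>
     (\<exists>F. hilbert_series L\<sigma> = 112 * fps_X ^ 2 + 6284 * fps_X ^ 3 + fps_X ^ 4 * F) \<and>
     hdepth 101 L\<sigma> = hdepth 100 L + 1 \<and> hdepth 101 L\<sigma> \<le> 55 \<and>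
     int (hdepth 101 L\<sigma>) \<noteq> \<lfloor>6284 / 112 :: real\<rfloor> \<and> \<lfloor>6284 / 112 :: real\<rfloor> = 56"
proof -
  let ?B = "lex_monomials 100 13"
  have image: "{Var 1 * Var j | j. j \<in> {1 + q..100 + q}} \<union> {Var 2 * Var j | j. j \<in> {2 + q..13 + q}} =
      (monomial ` lex_gens 100 13 q :: 'k mpoly set)" for q
    unfolding Var_mult_Var lex_gens_def by blast
  have L_gens: "L = ideal_gen 100 (monomial ` lex_gens 100 13 0)"
    using image[of 0] by (simp add: L)
  have L\<sigma>_gens: "L\<sigma> = ideal_gen 101 (monomial ` lex_gens 100 13 1)"
  proof -
    have "1 + 1 = (2::nat)" "100 + 1 = (101::nat)" "2 + 1 = (3::nat)" "13 + 1 = (14::nat)" by simp_all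
    from image[of 1, unfolded this] show ?thesis by (simp only: L\<sigma>)
  qed
  have L_eq: "L = supported_on (?B 0)"
    unfolding L_gens by (rule ideal_gen_lex_gens) simp_all
  have L\<sigma>_eq: "L\<sigma> = supported_on (?B 1)"
    unfolding L\<sigma>_gens by (rule ideal_gen_lex_gens) simp_all
  have sub: "?B 0 \<subseteq> monomials_in {1..100}" "?B 1 \<subseteq> monomials_in {1..101}"
    using lex_monomials_subset[of 13 100 0] lex_monomials_subset[of 13 100 1] by simp_all
  have series: "monomial_series (?B 0) = lex_series 100 13"
      "monomial_series (?B 1) = geom * lex_series 100 13"
    using monomial_series_lex_monomials[of 13 100 0] monomial_series_lex_monomials[of 13 100 1] by simp_all
  \<comment> \<open>The nonzero coefficient found for the obstruction also shows that the series is
    nonzero.\<close>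
  have nz: "monomial_series (?B 0) \<noteq> 0"
    using lex_series_100_13_negative_coeff unfolding series by force
  have ne: "decomposition_hdepths 100 (supported_on (?B 0) :: 'k mpoly set) \<noteq> {}"
  proof -
    obtain D where D: "decomposition_series D = lex_series 100 13" "\<forall>(Z, s)\<in>set D. Z \<subseteq> {1..100}"
      using lex_series_decomposition[of 13 100] by auto
    then have "decomposition_hdepth D \<in> decomposition_hdepths 100 (supported_on (?B 0) :: 'k mpoly set)"
      using series(1) by (intro decomposition_hdepthsI[OF sub(1)]) auto
    then show ?thesis by blast
  qed
  have depth_le: "hdepth 100 L \<le> 54"
  proof -
    have "d \<le> 54" if d: "d \<in> decomposition_hdepths 100 (supported_on (?B 0) :: 'k mpoly set)" for d
    proof (rule ccontr)
      assume "\<not> d \<le> 54"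
      obtain D where D: "D \<noteq> []" "decomposition_hdepth D = d" "monomial_series (?B 0) = decomposition_series D"
          "\<And>Z s. (Z, s) \<in> set D \<Longrightarrow> d \<le> card Z"
        using d sub(1) nz by (rule decomposition_hdepthsE) blast
      \<comment> \<open>A depth above 54 is weakened to exactly 55, the exponent of the
        obstruction.\<close>
      have "55 \<le> card Z" if "(Z, s) \<in> set D" for Z s
        using D(4)[OF that] \<open>\<not> d \<le> 54\<close> by simp
      then have "0 \<le> ((1 - fps_X) ^ 55 * decomposition_series D) $ 5"
        by (rule decomposition_hdepth_obstruction)
      then show False
        using D(3) lex_series_100_13_negative_coeff series(1) by simp
    qed
    then show ?thesis
      using Max_in[OF finite_decomposition_hdepths[OF sub(1) nz] ne] by (simp add: L_eq hdepth_eq_Max)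
  qed
  have depth_eq: "hdepth 101 L\<sigma> = hdepth 100 L + 1"
    using hdepth_Suc[of "?B 0" 100 "?B 1", where 'k = 'k] sub nz ne series by (simp add: L_eq L\<sigma>_eq)
  have floor: "\<lfloor>6172 / 112 :: real\<rfloor> = 55" "\<lfloor>6284 / 112 :: real\<rfloor> = 56"
    by (simp_all add: floor_eq_iff)
  have deg: "\<forall>u\<in>lex_gens 100 13 q. mdeg u = 2" for q
    by (auto simp: lex_gens_def)
  show ?thesis
  proof (intro conjI)
    show "is_lex_ideal 100 L"
      unfolding L_eq by (rule is_lex_ideal_lex_monomials) simp_all
    show "\<exists>M \<subseteq> {u \<in> monomials_in {1..100}. mdeg u = 2}. L = ideal_gen 100 (monomial ` M)"
      using lex_gens_subset[of 13 100 0] deg L_gens by (intro exI[of _ "lex_gens 100 13 0"]) auto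
    show "is_squarefree_lex_ideal 101 L\<sigma>"
      using is_squarefree_lex_ideal_lex_monomials[of 13 100, where 'k = 'k] by (simp add: L\<sigma>_eq)
    show "\<exists>M \<subseteq> {u \<in> squarefree_monomials_in {1..101}. mdeg u = 2}. L\<sigma> = ideal_gen 101 (monomial ` M)"
      using lex_gens_squarefree[of 13 100] deg L\<sigma>_gens by (intro exI[of _ "lex_gens 100 13 1"]) auto
    show "\<exists>F. hilbert_series L = 112 * fps_X ^ 2 + 6172 * fps_X ^ 3 + fps_X ^ 4 * F"
      unfolding L_eq hilbert_series_supported_on series by (rule lex_series_100_13_two_terms)
    show "\<exists>F. hilbert_series L\<sigma> = 112 * fps_X ^ 2 + 6284 * fps_X ^ 3 + fps_X ^ 4 * F"
      unfolding L\<sigma>_eq hilbert_series_supported_on series by (rule lex_series_100_13_two_terms)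
  qed (use depth_le depth_eq floor in simp_all)
qed

end
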